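(* Let $s\geq 2$ and $r\geq 1$ be integers, and let $m_1,m_2,\dots,m_s\geq 1$ be integers. Put $M:=\sum_{i=1}^{s}m_i$. Then the $r$-independence complex of the complete $s$-partite graph $K_{m_1,\dots,m_s}$ satisfies $$\mathrm{Ind}_r(K_{m_1,\dots,m_s})\simeq \bigvee_{t}\mathbb{S}^{r-1},\qquad\text{where } t=\binom{M-1}{r}-\sum_{i=1}^{s}\binom{m_i-1}{r}.$$
   Context: Graphs are finite, simple and undirected. For a graph $G$ and an integer $r\geq 1$, a subset $I\subseteq V(G)$ is $r$-independent if every connected component of the induced subgraph $G[I]$ has at most $r$ vertices. The $r$-independence complex $\mathrm{Ind}_r(G)$ is the simplicial complex on vertex set $V(G)$ whose simplices are all $r$-independent subsets of $V(G)$ (it is identified with its geometric realization). The complete $s$-partite graph $K_{m_1,\dots,m_s}$ has vertex set a disjoint union $V_1\sqcup\dots\sqcup V_s$ with $|V_i|=m_i$, where no two vertices in the same $V_i$ are adjacent and every vertex of $V_i$ is adjacent to every vertex of $V_j$ for $i\neq j$. Here $\simeq$ denotes homotopy equivalence, $\bigvee_t \mathbb{S}^q$ denotes a wedge of $t$ copies of the $q$-sphere (a point if $t=0$), and $\binom{a}{b}=0$ for integers $0\le a<b$. *)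

theory Defs
  imports "HOL-Analysis.Analysis" "Graph_Theory.Graph_Theory"
begin

text \<open>
  A finite simple undirected graph is a digraph satisfying \<^locale>\<open>graph\<close>, i.e. a finite, loop-free,
  symmetric digraph without parallel arcs; its edges are the pairs in \<^const>\<open>arcs_ends\<close>.
  The next definition extends \<^const>\<open>complete_bipartite_digraph\<close> to \<open>s\<close> parts and, like it,
  describes the graph up to isomorphism.
\<close>

definition complete_multipartite_digraph ::
    "nat \<Rightarrow> (nat \<Rightarrow> nat) \<Rightarrow> ('a, 'b) pre_digraph \<Rightarrow> bool" where
  "complete_multipartite_digraph s m G \<longleftrightarrow> graph G \<and>
     (\<exists>V. disjoint_family_on V {1..s} \<and>
          verts G = (\<Union>i\<in>{1..s}. V i) \<and>
          (\<forall>i\<in>{1..s}. card (V i) = m i) \<and>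
          arcs_ends G = (\<Union>i\<in>{1..s}. \<Union>j\<in>{1..s} - {i}. V i \<times> V j))"

lemma complete_multipartite_digraph_exists:
  "complete_multipartite_digraph s m
     (with_proj \<lparr> pverts = (SIGMA i:{1..s}. {..<m i}),
        parcs = {(u, v). u \<in> (SIGMA i:{1..s}. {..<m i}) \<and> v \<in> (SIGMA i:{1..s}. {..<m i})
                   \<and> fst u \<noteq> fst v} \<rparr>)" (is "complete_multipartite_digraph s m (with_proj ?G)")
proof -
  let ?W = "SIGMA i:{1..s}. {..<m i}"
  have "finite (parcs ?G)"
    by (rule finite_subset[of _ "?W \<times> ?W"]) auto
  then interpret pair_graph ?G
    by unfold_locales (auto simp: symmetric_def sym_def)
  show ?thesis
    unfolding complete_multipartite_digraph_def
  proof (intro conjI exI[of _ "\<lambda>i. {i} \<times> {..<m i}"])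
    show "graph (with_proj ?G)" by unfold_locales
  qed (auto simp: disjoint_family_on_def card_cartesian_product_singleton)
qed

definition connected_components :: "('a, 'b) pre_digraph \<Rightarrow> ('a, 'b) pre_digraph set" where
  "connected_components G = {H. pre_digraph.max_subgraph G Digraph_Component.connected H}"

definition r_independent :: "nat \<Rightarrow> ('a, 'b) pre_digraph \<Rightarrow> 'a set \<Rightarrow> bool" where
  "r_independent r G I \<longleftrightarrow>
     I \<subseteq> verts G \<and> (\<forall>H\<in>connected_components (G \<restriction> I). card (verts H) \<le> r)"

definition independence_complex :: "nat \<Rightarrow> ('a, 'b) pre_digraph \<Rightarrow> 'a set set" where
  "independence_complex r G = {I. r_independent r G I}"

text \<open>
  The geometric realization of a finite abstract simplicial complex in barycentric coordinates:
  a point is a convex combination of vertices whose support is a simplex. For infinite complexes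
  the product topology used here would be coarser than the usual weak topology.
\<close>

definition geometric_realization :: "'a set set \<Rightarrow> ('a \<Rightarrow> real) topology" where
  "geometric_realization K = subtopology (powertop_real UNIV)
     {x. (\<forall>v. 0 \<le> x v) \<and> {v. x v \<noteq> 0} \<in> K \<and> (\<Sum>v | x v \<noteq> 0. x v) = 1}"

text \<open>
  The wedge of the pointed spaces \<open>(X i, p i)\<close>, \<open>i \<in> I\<close>: the points \<open>p i\<close> are all identified with
  the common basepoint \<^const>\<open>None\<close>, which is present even if \<open>I\<close> is empty, and the topology is
  the final one with respect to the canonical maps from the \<open>X i\<close>.
\<close>

definition wedge_map :: "('i \<Rightarrow> 'a) \<Rightarrow> 'i \<Rightarrow> 'a \<Rightarrow> ('i \<times> 'a) option" where
  "wedge_map p i x = (if x = p i then None else Some (i, x))"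

definition wedge_topology ::
    "'i set \<Rightarrow> ('i \<Rightarrow> 'a topology) \<Rightarrow> ('i \<Rightarrow> 'a) \<Rightarrow> ('i \<times> 'a) option topology" where
  "wedge_topology I X p = topology (\<lambda>U.
     U \<subseteq> insert None (\<Union>i\<in>I. wedge_map p i ` topspace (X i)) \<and>
     (\<forall>i\<in>I. openin (X i) {x \<in> topspace (X i). wedge_map p i x \<in> U}))"

lemma openin_wedge_topology:
  "openin (wedge_topology I X p) U \<longleftrightarrow>
     U \<subseteq> insert None (\<Union>i\<in>I. wedge_map p i ` topspace (X i)) \<and>
     (\<forall>i\<in>I. openin (X i) {x \<in> topspace (X i). wedge_map p i x \<in> U})"
proof -
  let ?W = "insert None (\<Union>i\<in>I. wedge_map p i ` topspace (X i))"
  let ?P = "\<lambda>U. U \<subseteq> ?W \<and> (\<forall>i\<in>I. openin (X i) {x \<in> topspace (X i). wedge_map p i x \<in> U})"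
  have "istopology ?P"
    unfolding istopology_def
  proof (intro conjI allI impI)
    fix S T assume S: "?P S" and T: "?P T"
    show "S \<inter> T \<subseteq> ?W" using S by blast
    show "\<forall>i\<in>I. openin (X i) {x \<in> topspace (X i). wedge_map p i x \<in> S \<inter> T}"
    proof
      fix i assume "i \<in> I"
      have "{x \<in> topspace (X i). wedge_map p i x \<in> S \<inter> T} =
          {x \<in> topspace (X i). wedge_map p i x \<in> S} \<inter> {x \<in> topspace (X i). wedge_map p i x \<in> T}"
        by blast
      then show "openin (X i) {x \<in> topspace (X i). wedge_map p i x \<in> S \<inter> T}"
        using S T \<open>i \<in> I\<close> by (simp add: openin_Int)
    qed
  next
    fix K assume K: "\<forall>S\<in>K. ?P S"
    show "\<Union>K \<subseteq> ?W" using K by blast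
    show "\<forall>i\<in>I. openin (X i) {x \<in> topspace (X i). wedge_map p i x \<in> \<Union>K}"
    proof
      fix i assume "i \<in> I"
      have "{x \<in> topspace (X i). wedge_map p i x \<in> \<Union>K} =
          (\<Union>S\<in>K. {x \<in> topspace (X i). wedge_map p i x \<in> S})"
        by blast
      moreover have "openin (X i) (\<Union>S\<in>K. {x \<in> topspace (X i). wedge_map p i x \<in> S})"
        using K \<open>i \<in> I\<close> by (intro openin_Union) auto
      ultimately show "openin (X i) {x \<in> topspace (X i). wedge_map p i x \<in> \<Union>K}" by simp
    qed
  qed
  then show ?thesis
    unfolding wedge_topology_def by (simp only: topology_inverse')
qed

lemma topspace_wedge_topology:
  "topspace (wedge_topology I X p) = insert None (\<Union>i\<in>I. wedge_map p i ` topspace (X i))"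
    (is "_ = ?W")
proof
  show "topspace (wedge_topology I X p) \<subseteq> ?W"
    using openin_topspace[of "wedge_topology I X p"] unfolding openin_wedge_topology by (rule conjunct1)
  have "{x \<in> topspace (X i). wedge_map p i x \<in> ?W} = topspace (X i)" if "i \<in> I" for i
    using that by blast
  then have "openin (wedge_topology I X p) ?W"
    unfolding openin_wedge_topology by simp
  then show "?W \<subseteq> topspace (wedge_topology I X p)" by (rule openin_subset)
qed

lemma quotient_map_wedge_topology:
  assumes "I \<noteq> {}" and "\<And>i. i \<in> I \<Longrightarrow> p i \<in> topspace (X i)"
  shows "quotient_map (sum_topology X I) (wedge_topology I X p) (\<lambda>(i, x). wedge_map p i x)"
proof -
  obtain j where "j \<in> I" using assms(1) by blast
  then have "None \<in> wedge_map p j ` topspace (X j)"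
    using assms(2) by (force simp: wedge_map_def)
  with \<open>j \<in> I\<close> have img: "(\<lambda>(i, x). wedge_map p i x) ` topspace (sum_topology X I) =
      topspace (wedge_topology I X p)"
    unfolding topspace_wedge_topology topspace_sum_topology by force
  have "openin (sum_topology X I)
          {z \<in> topspace (sum_topology X I). (case z of (i, x) \<Rightarrow> wedge_map p i x) \<in> U} \<longleftrightarrow>
        openin (wedge_topology I X p) U"
    if U: "U \<subseteq> topspace (wedge_topology I X p)" for U
  proof -
    have "{x. (i, x) \<in> {z \<in> topspace (sum_topology X I). (case z of (i, x) \<Rightarrow> wedge_map p i x) \<in> U}}
        = {x \<in> topspace (X i). wedge_map p i x \<in> U}" if "i \<in> I" for i
      using that by simp
    moreover have "{z \<in> topspace (sum_topology X I). (case z of (i, x) \<Rightarrow> wedge_map p i x) \<in> U}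
        \<subseteq> Sigma I (topspace \<circ> X)"
      by auto
    ultimately show ?thesis
      using U unfolding topspace_wedge_topology openin_wedge_topology openin_sum_topology by simp
  qed
  with img show ?thesis unfolding quotient_map_def by blast
qed

text \<open>A wedge of \<open>t\<close> copies of the sphere; for \<open>n = 0\<close> each copy is a two-point space.\<close>

definition wedge_of_spheres :: "nat \<Rightarrow> nat \<Rightarrow> (nat \<times> (nat \<Rightarrow> real)) option topology" where
  "wedge_of_spheres t n =
     wedge_topology {..<t} (\<lambda>_. nsphere n) (\<lambda>_ k. if k = 0 then 1 else 0)"

end

theory Submission
  imports Defs
begin

text \<open>
  Write \<open>V i\<close> for the parts of the graph. A set of vertices is \<open>r\<close>-independent iff it has at most \<open>r\<close>
  elements or lies in a single part (\<open>r_independent_complete_multipartite\<close>). So the complex is the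
  full skeleton of dimension \<open>r - 1\<close> on all vertices, together with the full simplex on each \<open>V i\<close>.

  The full simplices are removed first. Choose a vertex \<open>c i\<close> in each part. A simplex with at least
  \<open>r\<close> vertices in \<open>V i - {c i}\<close> lies in \<open>V i\<close>, so such simplices can be matched by adding and
  removing \<open>c i\<close>, and the complex collapses onto the simplices with fewer than \<open>r\<close> vertices in each
  \<open>V i - {c i}\<close> (\<open>homotopy_equivalent_space_uncone\<close>, \<open>thin_out\<close>). What is left is the skeleton of
  dimension \<open>r - 1\<close> without the simplices of size \<open>r\<close> inside some \<open>V i - {c i}\<close>.

  Now fix one of the selected vertices, \<open>v0\<close>. The simplices with fewer than \<open>r\<close> vertices besides
  \<open>v0\<close> form a cone with apex \<open>v0\<close>. The other simplices are the sets of size \<open>r\<close> that avoid \<open>v0\<close> and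
  are not inside any \<open>V i - {c i}\<close>. There are \<open>(M - 1 choose r) - (\<Sum>i. (m i - 1) choose r)\<close> of them
  (\<open>card_facets\<close>), and each is attached to the cone along its boundary. Collapsing the contractible
  cone turns each of them into a sphere (\<open>skeleton_homotopy_equivalent_wedge\<close>). This also covers
  \<open>r = 1\<close>, where the cone is the point \<open>v0\<close> and the facets are the remaining vertices \<open>c i\<close>.

  Both steps use explicit formulas in barycentric coordinates. They depend on the \<open>r\<close>-th largest
  coordinate in a set of vertices, a continuous function which vanishes iff the carrier of a point
  has fewer than \<open>r\<close> vertices in that set. The second step extends the contraction of the cone to a
  homotopy of the whole space; that it makes the collapse a homotopy equivalence is
  \<open>homotopy_equivalent_space_quotient\<close>.
\<close>

section \<open>Homotopy equivalences induced by quotient maps\<close>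

lemma homotopic_withI:
  assumes "continuous_map (prod_topology (top_of_set {0..1::real}) X) Y h"
    and "\<And>x. x \<in> topspace X \<Longrightarrow> h (0, x) = f x"
    and "\<And>x. x \<in> topspace X \<Longrightarrow> h (1, x) = g x"
  shows "homotopic_with (\<lambda>_. True) X Y f g"
proof -
  have "\<exists>h. continuous_map (prod_topology (top_of_set {0..1::real}) X) Y h \<and>
      (\<forall>x\<in>topspace X. h (0, x) = f x) \<and> (\<forall>x\<in>topspace X. h (1, x) = g x) \<and>
      (\<forall>t\<in>{0..1::real}. True)"
    using assms by blast
  then show ?thesis by (subst homotopic_with) simp_all
qed

lemma quotient_map_factor:
  assumes f: "quotient_map X Y f" and h: "continuous_map X Z h"
    and const: "\<And>x y. \<lbrakk>x \<in> topspace X; y \<in> topspace X; f x = f y\<rbrakk> \<Longrightarrow> h x = h y"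
  shows "\<exists>g. continuous_map Y Z g \<and> (\<forall>x\<in>topspace X. g (f x) = h x)"
proof (rule quotient_map_lift_exists[OF f h])
  fix g assume "continuous_map Y Z g" "\<And>x. x \<in> topspace X \<Longrightarrow> g (f x) = h x"
  then show ?thesis by blast
qed (rule const)

text \<open>
  This generalizes the fact that collapsing a contractible subspace with the homotopy extension
  property is a homotopy equivalence; there \<open>F\<close> extends a contraction of the subspace to the
  whole space. The final map of \<open>F\<close> is constant on the fibres of \<open>q\<close>, so it factors as \<open>g \<circ> q\<close>, and
  \<open>F\<close> itself is a homotopy from \<open>id\<close> to \<open>g \<circ> q\<close>. Since \<open>F\<close> respects the fibres, it descends to a
  homotopy of \<open>Y\<close> from \<open>id\<close> to \<open>q \<circ> g\<close>. Both \<open>g\<close> and the descended homotopy are continuous because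
  \<open>q\<close> and \<open>id \<times> q\<close> are closed maps, from compact spaces onto Hausdorff spaces.
\<close>

lemma homotopy_equivalent_space_quotient:
  assumes X: "compact_space X" and Y: "Hausdorff_space Y"
    and q: "continuous_map X Y q" and onto: "q ` topspace X = topspace Y"
    and F: "continuous_map (prod_topology (top_of_set {0..1::real}) X) X F"
    and F0: "\<And>x. x \<in> topspace X \<Longrightarrow> F (0, x) = x"
    and fibres: "\<And>t x y. \<lbrakk>t \<in> {0..1}; x \<in> topspace X; y \<in> topspace X; q x = q y\<rbrakk>
                   \<Longrightarrow> q (F (t, x)) = q (F (t, y))"
    and F1: "\<And>x y. \<lbrakk>x \<in> topspace X; y \<in> topspace X; q x = q y\<rbrakk> \<Longrightarrow> F (1, x) = F (1, y)"
  shows "X homotopy_equivalent_space Y"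
proof -
  let ?I = "top_of_set {0..1::real}"
  let ?Q = "\<lambda>(t::real, x). (t, q x)"
  have quot: "quotient_map X Y q"
    by (rule continuous_imp_quotient_map[OF q X Y onto])
  have F1c: "continuous_map X X (F \<circ> Pair 1)"
    by (rule continuous_map_o_Pair[OF F]) simp
  have "\<exists>g. continuous_map Y X g \<and> (\<forall>x\<in>topspace X. g (q x) = (F \<circ> Pair 1) x)"
    by (rule quotient_map_factor[OF quot F1c]) (unfold comp_def, rule F1)
  then obtain g where g: "continuous_map Y X g" and "\<forall>x\<in>topspace X. g (q x) = (F \<circ> Pair 1) x"
    by blast
  then have gq: "g (q x) = F (1, x)" if "x \<in> topspace X" for x
    using that by simp
  have "continuous_map (prod_topology ?I X) (prod_topology ?I Y) ?Q"
    using q continuous_map_prod_top[of ?I X ?I Y "\<lambda>t. t" q] by simp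
  moreover have "compact_space (prod_topology ?I X)"
    using X by (simp add: compact_space_prod_topology compact_space_subtopology)
  moreover have "Hausdorff_space (prod_topology ?I Y)"
    using Y by (simp add: Hausdorff_space_prod_topology Hausdorff_space_subtopology)
  moreover have "?Q ` topspace (prod_topology ?I X) = topspace (prod_topology ?I Y)"
    by (auto simp flip: onto)
  ultimately have quot2: "quotient_map (prod_topology ?I X) (prod_topology ?I Y) ?Q"
    by (rule continuous_imp_quotient_map)
  have qF: "continuous_map (prod_topology ?I X) Y (q \<circ> F)"
    by (rule continuous_map_compose[OF F q])
  have "\<exists>k. continuous_map (prod_topology ?I Y) Y k \<and>
      (\<forall>z\<in>topspace (prod_topology ?I X). k (?Q z) = (q \<circ> F) z)"
  proof (rule quotient_map_factor[OF quot2 qF])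
    fix z z'
    assume "z \<in> topspace (prod_topology ?I X)" "z' \<in> topspace (prod_topology ?I X)" "?Q z = ?Q z'"
    then have z: "fst z \<in> {0..1}" "snd z \<in> topspace X" "snd z' \<in> topspace X" "q (snd z) = q (snd z')"
      and eq: "fst z = fst z'"
      by (simp_all add: case_prod_unfold mem_Times_iff)
    show "(q \<circ> F) z = (q \<circ> F) z'"
      using fibres[OF z] eq by (metis comp_apply prod.collapse)
  qed
  then obtain k where k: "continuous_map (prod_topology ?I Y) Y k"
    and kQ': "\<forall>z\<in>topspace (prod_topology ?I X). k (?Q z) = (q \<circ> F) z"
    by blast
  have kQ: "k (t, q x) = q (F (t, x))" if "t \<in> {0..1}" "x \<in> topspace X" for t x
    using bspec[OF kQ', of "(t, x)"] that by simp
  have "homotopic_with (\<lambda>_. True) X X id (g \<circ> q)"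
    by (rule homotopic_withI[OF F]) (simp_all add: F0 gq)
  then have gq_id: "homotopic_with (\<lambda>_. True) X X (g \<circ> q) id"
    by (rule homotopic_with_symD)
  have "homotopic_with (\<lambda>_. True) Y Y id (q \<circ> g)"
  proof (rule homotopic_withI[OF k])
    fix y assume "y \<in> topspace Y"
    then obtain x where x: "x \<in> topspace X" "y = q x" using onto by blast
    show "k (0, y) = id y" using kQ[of 0 x] x F0 by simp
    show "k (1, y) = (q \<circ> g) y" using kQ[of 1 x] x gq by simp
  qed
  then have qg_id: "homotopic_with (\<lambda>_. True) Y Y (q \<circ> g) id"
    by (rule homotopic_with_symD)
  show ?thesis
    unfolding homotopy_equivalent_space_def
    by (intro exI[of _ q] exI[of _ g] conjI q g gq_id qg_id)
qed

section \<open>Wedges\<close>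

lemma continuous_map_wedge_map:
  assumes "i \<in> I"
  shows "continuous_map (X i) (wedge_topology I X p) (wedge_map p i)"
  unfolding continuous_map_def openin_wedge_topology topspace_wedge_topology
  using assms by auto

text \<open>
  For every summand \<open>X i\<close>, collapsing all the other summands to the base point is a continuous map
  \<open>c i\<close> from the wedge onto \<open>X i\<close>. Any two points of the wedge are separated by one of these maps.
\<close>

lemma Hausdorff_space_wedge_topology:
  assumes X: "\<And>i. i \<in> I \<Longrightarrow> Hausdorff_space (X i)"
    and p: "\<And>i. i \<in> I \<Longrightarrow> p i \<in> topspace (X i)"
  shows "Hausdorff_space (wedge_topology I X p)"
proof -
  let ?W = "wedge_topology I X p"
  define c where "c i z = (case z of None \<Rightarrow> p i | Some (j, x) \<Rightarrow> if j = i then x else p i)" for i z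
  have c_map: "c i (wedge_map p j x) = (if j = i then x else p i)" for i j x
    by (auto simp: c_def wedge_map_def)
  have c_cont: "continuous_map ?W (X i) (c i)" if i: "i \<in> I" for i
    unfolding continuous_map_def
  proof (intro conjI allI impI)
    show "c i \<in> topspace ?W \<rightarrow> topspace (X i)"
      using i p by (auto simp: topspace_wedge_topology c_map) (auto simp: c_def)
    fix U assume U: "openin (X i) U"
    have "openin (X j) {x \<in> topspace (X j). c i (wedge_map p j x) \<in> U}" if "j \<in> I" for j
    proof (cases "j = i")
      case True
      then show ?thesis using U openin_subset[OF U] by (simp add: c_map Collect_conj_eq Int_absorb1)
    next
      case False
      then show ?thesis by (cases "p i \<in> U") (auto simp: c_map)
    qed
    moreover have "{x \<in> topspace (X j). wedge_map p j x \<in> {z \<in> topspace ?W. c i z \<in> U}}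
        = {x \<in> topspace (X j). c i (wedge_map p j x) \<in> U}" if "j \<in> I" for j
      using that by (auto simp: topspace_wedge_topology)
    ultimately show "openin ?W {z \<in> topspace ?W. c i z \<in> U}"
      unfolding openin_wedge_topology by (auto simp: topspace_wedge_topology)
  qed
  have separated: "\<exists>i\<in>I. c i y \<noteq> c i z"
    if y: "y \<in> topspace ?W" and z: "z \<in> topspace ?W" and "y \<noteq> z" for y z
  proof -
    have cases: "u = None \<or> (\<exists>i x. u = Some (i, x) \<and> i \<in> I \<and> x \<noteq> p i)" if "u \<in> topspace ?W" for u
      using that by (auto simp: topspace_wedge_topology wedge_map_def)
    have ne_base: "c i (Some (i, x)) \<noteq> c i u" if "x \<noteq> p i" "u \<noteq> Some (i, x)" for i x u
      using that by (cases u) (auto simp: c_def split: if_splits)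
    from cases[OF y] show ?thesis
    proof
      assume "y = None"
      then show ?thesis using cases[OF z] \<open>y \<noteq> z\<close> ne_base by metis
    next
      assume "\<exists>i x. y = Some (i, x) \<and> i \<in> I \<and> x \<noteq> p i"
      then show ?thesis using ne_base \<open>y \<noteq> z\<close> by metis
    qed
  qed
  show ?thesis
    unfolding Hausdorff_space_def
  proof (intro allI impI)
    fix y z assume yz: "y \<in> topspace ?W \<and> z \<in> topspace ?W \<and> y \<noteq> z"
    then obtain i where i: "i \<in> I" and ne: "c i y \<noteq> c i z" using separated by blast
    have "c i y \<in> topspace (X i)" "c i z \<in> topspace (X i)"
      using continuous_map_image_subset_topspace[OF c_cont[OF i]] yz by auto
    then obtain U V where UV: "openin (X i) U" "openin (X i) V" "c i y \<in> U" "c i z \<in> V" "disjnt U V"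
      using X[OF i] ne unfolding Hausdorff_space_def by blast
    have "disjnt {w \<in> topspace ?W. c i w \<in> U} {w \<in> topspace ?W. c i w \<in> V}"
      using UV(5) by (auto simp: disjnt_iff)
    moreover have "openin ?W {w \<in> topspace ?W. c i w \<in> U}" "openin ?W {w \<in> topspace ?W. c i w \<in> V}"
      using UV(1,2) openin_continuous_map_preimage[OF c_cont[OF i]] by blast+
    ultimately show "\<exists>U V. openin ?W U \<and> openin ?W V \<and> y \<in> U \<and> z \<in> V \<and> disjnt U V"
      using UV(3,4) yz by (intro exI conjI; assumption?) auto
  qed
qed

section \<open>Realizations and the k-th largest coordinate\<close>

definition realization :: "'a set set \<Rightarrow> ('a \<Rightarrow> real) set" where
  "realization K = {x. (\<forall>v. 0 \<le> x v) \<and> {v. x v \<noteq> 0} \<in> K \<and> (\<Sum>v | x v \<noteq> 0. x v) = 1}"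

lemma geometric_realization_eq_top_of_set: "geometric_realization K = top_of_set (realization K)"
  by (simp add: geometric_realization_def realization_def euclidean_product_topology)

lemma mem_realization_iff:
  assumes "finite V" "K \<subseteq> Pow V"
  shows "x \<in> realization K \<longleftrightarrow> (\<forall>v. 0 \<le> x v) \<and> {v. x v \<noteq> 0} \<in> K \<and> sum x V = 1"
proof -
  have "(\<Sum>v | x v \<noteq> 0. x v) = sum x V" if "{v. x v \<noteq> 0} \<in> K"
    using assms that by (intro sum.mono_neutral_left) auto
  then show ?thesis by (auto simp: realization_def)
qed

lemma compact_realization:
  assumes V: "finite V" "K \<subseteq> Pow V" and down: "\<And>\<sigma> \<tau>. \<sigma> \<in> K \<Longrightarrow> \<tau> \<subseteq> \<sigma> \<Longrightarrow> \<tau> \<in> K"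
  shows "compact (realization K)"
proof -
  let ?C = "\<lambda>\<sigma>. Pi\<^sub>E UNIV (\<lambda>v. if v \<in> \<sigma> then {0..1::real} else {0}) \<inter> {x. sum x V = 1}"
  have "compact (?C \<sigma>)" for \<sigma>
  proof (rule compact_Int_closed)
    have "compactin (product_topology (\<lambda>_. euclideanreal) UNIV) (Pi\<^sub>E UNIV (\<lambda>v. if v \<in> \<sigma> then {0..1::real} else {0}))"
      by (auto simp: compactin_PiE)
    then show "compact (Pi\<^sub>E UNIV (\<lambda>v. if v \<in> \<sigma> then {0..1::real} else {0}))"
      by (simp add: euclidean_product_topology)
    show "closed {x :: 'a \<Rightarrow> real. sum x V = 1}"
      by (intro closed_Collect_eq continuous_on_sum continuous_on_product_coordinates continuous_on_const)
  qed
  moreover have "finite K" using V by (meson finite_Pow_iff finite_subset)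
  moreover have eq: "realization K = (\<Union>\<sigma>\<in>K. ?C \<sigma>)"
  proof (intro equalityI subsetI)
    fix x assume "x \<in> realization K"
    then have x: "\<And>v. 0 \<le> x v" "{v. x v \<noteq> 0} \<in> K" "sum x V = 1"
      by (auto simp: mem_realization_iff[OF V])
    have "x v \<le> 1" if "x v \<noteq> 0" for v
    proof -
      have "v \<in> V" using that x(2) V by auto
      then show ?thesis using member_le_sum[of v V x] x V by auto
    qed
    then have "x \<in> ?C {v. x v \<noteq> 0}" using x by auto
    then show "x \<in> (\<Union>\<sigma>\<in>K. ?C \<sigma>)" using x(2) by blast
  next
    fix x assume "x \<in> (\<Union>\<sigma>\<in>K. ?C \<sigma>)"
    then obtain \<sigma> where \<sigma>: "\<sigma> \<in> K" and x: "sum x V = 1"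
      and x': "\<And>v. x v \<in> (if v \<in> \<sigma> then {0..1} else {0})"
      by (auto simp: PiE_iff)
    have "0 \<le> x v" for v using x'[of v] by (auto split: if_splits)
    moreover have "{v. x v \<noteq> 0} \<subseteq> \<sigma>" using x' by (force split: if_splits)
    ultimately show "x \<in> realization K"
      using x down[OF \<sigma>] by (simp add: mem_realization_iff[OF V])
  qed
  ultimately show ?thesis unfolding eq by (intro compact_UN) auto
qed

text \<open>
  The \<open>k\<close>-th largest of the values \<open>x b\<close>, \<open>b \<in> B\<close>, cut off at zero; it is zero if \<open>B\<close> has fewer
  than \<open>k\<close> elements. The formula as a maximum of minima makes the continuity in \<open>x\<close> evident. For
  \<open>k \<ge> 1\<close> and barycentric coordinates \<open>x\<close>, the value is zero iff the carrier simplex of \<open>x\<close> has fewer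
  than \<open>k\<close> vertices in \<open>B\<close>.
\<close>

definition kth_largest :: "nat \<Rightarrow> 'a set \<Rightarrow> ('a \<Rightarrow> real) \<Rightarrow> real" where
  "kth_largest k B x = Max (insert 0 ((\<lambda>T. Min (x ` T)) ` {T. T \<subseteq> B \<and> card T = k}))"

lemma continuous_on_Max:
  fixes f :: "'i \<Rightarrow> 'b::topological_space \<Rightarrow> real"
  assumes "finite I" "I \<noteq> {}" "\<And>i. i \<in> I \<Longrightarrow> continuous_on S (f i)"
  shows "continuous_on S (\<lambda>x. Max ((\<lambda>i. f i x) ` I))"
  using assms by (induction I rule: finite_ne_induct) (auto intro!: continuous_on_max)

lemma continuous_on_Min:
  fixes f :: "'i \<Rightarrow> 'b::topological_space \<Rightarrow> real"
  assumes "finite I" "I \<noteq> {}" "\<And>i. i \<in> I \<Longrightarrow> continuous_on S (f i)"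
  shows "continuous_on S (\<lambda>x. Min ((\<lambda>i. f i x) ` I))"
  using assms by (induction I rule: finite_ne_induct) (auto intro!: continuous_on_min)

context
  fixes B :: "'a set" and k :: nat
  assumes finB: "finite B" and k: "k \<ge> 1"
begin

lemma finite_Mins: "finite ((\<lambda>T. Min (x ` T)) ` {T. T \<subseteq> B \<and> card T = k})"
  using finB by simp

lemma continuous_on_kth_largest:
  fixes f :: "'b::topological_space \<Rightarrow> 'a \<Rightarrow> real"
  assumes "\<And>v. continuous_on S (\<lambda>z. f z v)"
  shows "continuous_on S (\<lambda>z. kth_largest k B (f z))"
proof (cases "{T. T \<subseteq> B \<and> card T = k} = {}")
  case True
  show ?thesis by (simp only: kth_largest_def True image_empty Max_singleton continuous_on_const)
next
  case False
  have "continuous_on S (\<lambda>z. Min ((\<lambda>v. f z v) ` T))" if "T \<subseteq> B" "card T = k" for T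
    using that k finB assms by (intro continuous_on_Min) (auto simp: finite_subset)
  then have "continuous_on S (\<lambda>z. max 0 (Max ((\<lambda>T. Min (f z ` T)) ` {T. T \<subseteq> B \<and> card T = k})))"
    using False finB by (intro continuous_on_max continuous_on_const continuous_on_Max) auto
  moreover have "kth_largest k B y = max 0 (Max ((\<lambda>T. Min (y ` T)) ` {T. T \<subseteq> B \<and> card T = k}))" for y
    unfolding kth_largest_def using finite_Mins False by (intro Max_insert) auto
  ultimately show ?thesis by simp
qed

lemma kth_largest_nonneg: "0 \<le> kth_largest k B x"
  unfolding kth_largest_def by (intro Max_ge) (auto simp: finB)

lemma kth_largest_ge: "T \<subseteq> B \<Longrightarrow> card T = k \<Longrightarrow> Min (x ` T) \<le> kth_largest k B x"
  unfolding kth_largest_def using finite_Mins by (intro Max_ge) auto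

lemma kth_largest_cases:
  obtains "kth_largest k B x = 0"
  | T where "T \<subseteq> B" "card T = k" "kth_largest k B x = Min (x ` T)"
proof -
  have "kth_largest k B x \<in> insert 0 ((\<lambda>T. Min (x ` T)) ` {T. T \<subseteq> B \<and> card T = k})"
    unfolding kth_largest_def using finite_Mins by (intro Max_in) auto
  then show thesis using that by auto
qed

lemma card_above_kth_largest: "card {b \<in> B. kth_largest k B x < x b} < k"
proof (rule ccontr)
  assume "\<not> ?thesis"
  then obtain T where T: "T \<subseteq> {b \<in> B. kth_largest k B x < x b}" "card T = k"
    using ex_card[of k "{b \<in> B. kth_largest k B x < x b}"] by (auto simp: not_less)
  have "finite T" using T k by (intro card_ge_0_finite) simp
  have "T \<noteq> {}" using T k by auto
  then have "kth_largest k B x < Min (x ` T)" using T \<open>finite T\<close> by auto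
  then show False using kth_largest_ge[of T x] T by auto
qed

lemma kth_largest_eq_0:
  assumes "card ({v. x v \<noteq> 0} \<inter> B) < k" "\<And>v. 0 \<le> x v"
  shows "kth_largest k B x = 0"
proof (cases rule: kth_largest_cases[of x])
  case (2 T)
  have "finite T" using 2 finB finite_subset by blast
  have "\<not> T \<subseteq> {v. x v \<noteq> 0} \<inter> B"
    using assms(1) 2(2) finB card_mono[of "{v. x v \<noteq> 0} \<inter> B" T] by auto
  then obtain v where "v \<in> T" "x v = 0" using 2 by auto
  then have "Min (x ` T) \<le> 0" using \<open>finite T\<close> Min_le[of "x ` T" "x v"] by simp
  then show ?thesis using kth_largest_nonneg[of x] 2 by simp
qed

lemma kth_largest_pos:
  assumes "k \<le> card ({v. x v \<noteq> 0} \<inter> B)" "\<And>v. 0 \<le> x v"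
  shows "0 < kth_largest k B x"
proof -
  obtain T where T: "T \<subseteq> {v. x v \<noteq> 0} \<inter> B" "card T = k"
    using ex_card[OF assms(1)] by blast
  have "finite T" using T k by (intro card_ge_0_finite) simp
  have "T \<noteq> {}" using T k by auto
  have "Min (x ` T) \<in> x ` T" using \<open>finite T\<close> \<open>T \<noteq> {}\<close> by (intro Min_in) auto
  then obtain v where "v \<in> T" "Min (x ` T) = x v" by blast
  then have "0 < Min (x ` T)" using T assms(2)[of v] by (auto simp: order_less_le)
  then show ?thesis using kth_largest_ge[of T x] T by auto
qed

lemma kth_largest_eq_Min:
  assumes T: "T \<subseteq> B" "card T = k" and sup: "{v. x v \<noteq> 0} \<inter> B \<subseteq> T" and nn: "\<And>v. 0 \<le> x v"
  shows "kth_largest k B x = Min (x ` T)"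
proof (rule antisym)
  have fin: "finite T" and ne: "T \<noteq> {}" using T k finB finite_subset by auto
  have pos: "0 \<le> Min (x ` T)" using fin ne nn by simp
  show "kth_largest k B x \<le> Min (x ` T)"
  proof (cases rule: kth_largest_cases[of x])
    case (2 U)
    show ?thesis
    proof (cases "U = T")
      case False
      have finU: "finite U" using 2(1) finB finite_subset by blast
      have "\<not> U \<subseteq> T" using False card_subset_eq[OF fin] 2 T by auto
      then obtain v where "v \<in> U" "x v = 0" using 2(1) sup by auto
      then have "Min (x ` U) \<le> 0" using finU Min_le[of "x ` U" "x v"] by simp
      then show ?thesis using pos 2 by simp
    qed (use 2 in simp)
  qed (use pos in simp)
  show "Min (x ` T) \<le> kth_largest k B x" by (rule kth_largest_ge[OF T])
qed

end

section \<open>Removing simplices below a cone\<close>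

text \<open>
  The simplices with at least \<open>k\<close> vertices in \<open>B\<close> come in pairs \<open>\<sigma> - {c}\<close>, \<open>\<sigma> \<union> {c}\<close>, so removing them
  all should be a collapse. An explicit deformation does this in one step: it decreases every
  coordinate in \<open>B\<close> by the \<open>k\<close>-th largest of these coordinates, stopping at zero, and gives the mass
  gained to the apex \<open>c\<close>. In the end fewer than \<open>k\<close> coordinates in \<open>B\<close> are left. The points that
  are moved are those whose carrier has at least \<open>k\<close> vertices in \<open>B\<close>, and for these the cone condition
  allows the coordinate at \<open>c\<close> to become positive.
\<close>

lemma homotopy_equivalent_space_uncone:
  assumes V: "finite V" "K \<subseteq> Pow V" "B \<subseteq> V" "c \<in> V" "c \<notin> B" and k: "k \<ge> 1"
    and down: "\<And>\<sigma> \<tau>. \<sigma> \<in> K \<Longrightarrow> \<tau> \<subseteq> \<sigma> \<Longrightarrow> \<tau> \<in> K"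
    and cone: "\<And>\<sigma>. \<sigma> \<in> K \<Longrightarrow> k \<le> card (\<sigma> \<inter> B) \<Longrightarrow> insert c \<sigma> \<in> K"
  shows "geometric_realization K homotopy_equivalent_space
         geometric_realization {\<sigma> \<in> K. card (\<sigma> \<inter> B) < k}"
proof -
  let ?K' = "{\<sigma> \<in> K. card (\<sigma> \<inter> B) < k}"
  have finB: "finite B" using V finite_subset by blast
  define \<kappa> where "\<kappa> = kth_largest k B"
  have \<kappa>_eq_0: "\<kappa> x = 0" if "card ({v. x v \<noteq> 0} \<inter> B) < k" "\<And>v. 0 \<le> x v" for x
    unfolding \<kappa>_def using that by (rule kth_largest_eq_0[OF finB k])
  have \<kappa>0: "0 \<le> \<kappa> x" for x
    unfolding \<kappa>_def by (rule kth_largest_nonneg[OF finB k])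
  define d where "d x v = (if v = c then \<Sum>b\<in>B. min (x b) (\<kappa> x) else 0)
      - (if v \<in> B then min (x v) (\<kappa> x) else 0)" for x v
  define h where "h = (\<lambda>(t::real, x) v. x v + t * d x v)"
  have mem: "x \<in> realization K \<longleftrightarrow> (\<forall>v. 0 \<le> x v) \<and> {v. x v \<noteq> 0} \<in> K \<and> sum x V = 1"
    "x \<in> realization ?K' \<longleftrightarrow> (\<forall>v. 0 \<le> x v) \<and> {v. x v \<noteq> 0} \<in> ?K' \<and> sum x V = 1" for x
    using V by (intro mem_realization_iff; auto)+
  have h_nn: "0 \<le> h (t, x) v" if t: "0 \<le> t" "t \<le> 1" and x: "x \<in> realization K" for t x v
  proof -
    have x: "0 \<le> x v" for v using x by (simp add: mem)
    have "t * min (x v) (\<kappa> x) \<le> 1 * x v" using t x \<kappa>0 by (intro mult_mono) auto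
    then show ?thesis
      using V x \<kappa>0[of x] t by (auto simp: h_def d_def intro!: add_nonneg_nonneg mult_nonneg_nonneg sum_nonneg)
  qed
  have h_sum: "sum (h (t, x)) V = sum x V" for t x
  proof -
    have "(\<Sum>v\<in>V. if v \<in> B then min (x v) (\<kappa> x) else 0) = (\<Sum>b\<in>B. min (x b) (\<kappa> x))"
      using V by (simp add: sum.inter_restrict[symmetric] Int_absorb1)
    then have "(\<Sum>v\<in>V. d x v) = 0"
      using V by (simp add: d_def sum_subtractf)
    then show ?thesis by (simp add: h_def sum.distrib sum_distrib_left[symmetric])
  qed
  have d0: "d x v = 0" if "\<kappa> x = 0" "\<And>v. 0 \<le> x v" for x v
  proof -
    have "min (x v) 0 = 0" for v using that(2)[of v] by simp
    then show ?thesis by (simp add: d_def that(1))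
  qed
  have h_supp: "{v. h (t, x) v \<noteq> 0} \<in> K" if t: "0 \<le> t" "t \<le> 1" and x: "x \<in> realization K" for t x
  proof (cases "\<kappa> x = 0")
    case True
    then have "h (t, x) = x" using d0[of x] x by (auto simp: h_def mem)
    then show ?thesis using x by (simp add: mem)
  next
    case False
    then have "\<not> card ({v. x v \<noteq> 0} \<inter> B) < k"
      using \<kappa>_eq_0[of x] x by (auto simp: mem)
    then have "insert c {v. x v \<noteq> 0} \<in> K" using x cone by (simp add: mem)
    moreover have "{v. h (t, x) v \<noteq> 0} \<subseteq> insert c {v. x v \<noteq> 0}"
      using x \<kappa>0[of x] by (auto simp: h_def d_def)
    ultimately show ?thesis by (rule down)
  qed
  have h_K: "h (t, x) \<in> realization K" if "t \<in> {0..1}" "x \<in> realization K" for t x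
    using that h_nn[of t x] h_supp[of t x] h_sum[of t x] by (simp add: mem)
  have h_K': "h (1, x) \<in> realization ?K'" if x: "x \<in> realization K" for x
  proof -
    have "card ({v. h (1, x) v \<noteq> 0} \<inter> B) \<le> card {b \<in> B. \<kappa> x < x b}"
      using V(5) finB by (intro card_mono) (auto simp: h_def d_def)
    also have "\<dots> < k"
      unfolding \<kappa>_def by (rule card_above_kth_largest[OF finB k])
    finally have "card ({v. h (1, x) v \<noteq> 0} \<inter> B) < k" .
    then show ?thesis using h_K[of 1 x] x by (simp add: mem)
  qed
  have h_fix: "h (t, x) = x" if "x \<in> realization ?K'" for t x
    using that d0[of x] \<kappa>_eq_0[of x] by (auto simp: h_def mem)
  have coord: "continuous_on S (\<lambda>z. snd z v)" for S :: "(real \<times> ('a \<Rightarrow> real)) set" and v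
    by (rule continuous_on_product_then_coordinatewise) (intro continuous_intros)
  have \<kappa>_cont: "continuous_on S (\<lambda>z. \<kappa> (snd z))" for S :: "(real \<times> ('a \<Rightarrow> real)) set"
    unfolding \<kappa>_def by (rule continuous_on_kth_largest[OF finB k coord])
  have min_cont: "continuous_on S (\<lambda>z. min (snd z v) (\<kappa> (snd z)))" for S :: "(real \<times> ('a \<Rightarrow> real)) set" and v
    by (intro continuous_on_min coord \<kappa>_cont)
  have if_cont: "continuous_on S (\<lambda>z. if P then f z else 0)" if "continuous_on S f"
    for S :: "(real \<times> ('a \<Rightarrow> real)) set" and f :: "real \<times> ('a \<Rightarrow> real) \<Rightarrow> real" and P
    using that by (cases P) simp_all
  have "continuous_on S (\<lambda>z. h z v)" for S v
    unfolding h_def d_def case_prod_unfold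
    by (intro continuous_on_add continuous_on_mult continuous_on_diff continuous_on_fst
        continuous_on_id if_cont continuous_on_sum min_cont coord)
  then have h_cont: "continuous_on S h" for S
    by (rule continuous_on_coordinatewise_then_product)
  have h: "continuous_map (prod_topology (top_of_set {0..1}) (top_of_set (realization K)))
      (top_of_set (realization K)) h"
    using h_K h_cont by auto
  have h1_cont: "continuous_on (realization K) (\<lambda>x. h (1, x))"
    by (rule continuous_on_compose2[OF h_cont[of UNIV]]) (auto intro!: continuous_intros)
  have h1: "continuous_map (top_of_set (realization K)) (top_of_set (realization ?K')) (\<lambda>x. h (1, x))"
    using h1_cont h_K' by auto
  have sub: "realization ?K' \<subseteq> realization K" by (auto simp: realization_def)
  then have incl: "continuous_map (top_of_set (realization ?K')) (top_of_set (realization K)) id"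
    by auto
  have "homotopic_with (\<lambda>_. True) (top_of_set (realization K)) (top_of_set (realization K)) id (id \<circ> (\<lambda>x. h (1, x)))"
    by (rule homotopic_withI[OF h]) (auto simp: h_def)
  then have 1: "homotopic_with (\<lambda>_. True) (top_of_set (realization K)) (top_of_set (realization K))
      (id \<circ> (\<lambda>x. h (1, x))) id"
    by (rule homotopic_with_symD)
  have 2: "homotopic_with (\<lambda>_. True) (top_of_set (realization ?K')) (top_of_set (realization ?K'))
      ((\<lambda>x. h (1, x)) \<circ> id) id"
    by (rule homotopic_withI[OF continuous_map_snd]) (simp_all add: h_fix)
  show ?thesis
    unfolding geometric_realization_eq_top_of_set homotopy_equivalent_space_def
  proof (rule exI[of _ "\<lambda>x. h (1, x)"], rule exI[of _ id], intro conjI)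
  qed (fact h1 incl 1 2)+
qed

section \<open>A simplex modulo its boundary is a sphere\<close>

text \<open>
  This function collapses the boundary of the simplex with \<open>r\<close> vertices to the point \<open>(1, 0, 0, \<dots>)\<close> of
  the sphere and is injective elsewhere. It is the composition of two homeomorphisms: the interior
  of the simplex is mapped onto Euclidean space of dimension \<open>r - 1\<close> by \<open>z i = (u i - u 0) / m\<close>,
  \<open>0 < i < r\<close>, where \<open>m\<close> is the smallest coordinate; inverse stereographic projection follows. With
  denominators cleared, the formula extends to the boundary, where \<open>m = 0\<close>.
\<close>

definition sphere_coord :: "nat \<Rightarrow> (nat \<Rightarrow> real) \<Rightarrow> nat \<Rightarrow> real" where
  "sphere_coord r u i =
     (let m = Min (u ` {..<r}); D = (\<Sum>k<r. (u k - u 0)\<^sup>2) + m\<^sup>2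
      in if i = 0 then 1 - 2 * m\<^sup>2 / D else if i < r then 2 * m * (u i - u 0) / D else 0)"

definition std_simplex :: "nat \<Rightarrow> (nat \<Rightarrow> real) set" where
  "std_simplex r = {u. (\<forall>k<r. 0 \<le> u k) \<and> (\<Sum>k<r. u k) = 1}"

lemma sphere_coord_cong:
  assumes "r \<ge> 1" "\<And>k. k < r \<Longrightarrow> u k = u' k"
  shows "sphere_coord r u = sphere_coord r u'"
proof
  fix i
  have "u ` {..<r} = u' ` {..<r}" using assms by (intro image_cong) auto
  moreover have "(\<Sum>k<r. (u k - u 0)\<^sup>2) = (\<Sum>k<r. (u' k - u' 0)\<^sup>2)"
    using assms by (intro sum.cong) auto
  ultimately show "sphere_coord r u i = sphere_coord r u' i"
    using assms by (simp add: sphere_coord_def Let_def)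
qed

context
  fixes r :: nat
  assumes r: "r \<ge> 1"
begin

lemma Min_attained:
  fixes u :: "nat \<Rightarrow> real"
  obtains j where "j < r" "Min (u ` {..<r}) = u j"
proof -
  have "Min (u ` {..<r}) \<in> u ` {..<r}" using r by (intro Min_in) (auto simp: lessThan_empty_iff)
  then show thesis using that by blast
qed

lemma Min_le_coord:
  fixes u :: "nat \<Rightarrow> real"
  shows "k < r \<Longrightarrow> Min (u ` {..<r}) \<le> u k"
  by (intro Min_le) auto

text \<open>
  If the denominator vanishes, then all coordinates are equal and the smallest one is zero, so the
  coordinates do not sum up to one.
\<close>

lemma sphere_denom_pos:
  assumes u: "u \<in> std_simplex r"
  shows "0 < (\<Sum>k<r. (u k - u 0)\<^sup>2) + (Min (u ` {..<r}))\<^sup>2"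
proof (rule ccontr)
  let ?m = "Min (u ` {..<r})"
  assume "\<not> ?thesis"
  moreover have "0 \<le> (\<Sum>k<r. (u k - u 0)\<^sup>2)" by (intro sum_nonneg) simp
  moreover have "0 \<le> ?m\<^sup>2" by simp
  ultimately have 0: "(\<Sum>k<r. (u k - u 0)\<^sup>2) = 0" "?m\<^sup>2 = 0" by linarith+
  have eq: "u k = u 0" if "k < r" for k
  proof -
    have "(u k - u 0)\<^sup>2 = 0" by (rule sum_nonneg_0[OF _ _ 0(1)]) (use that in auto)
    then show ?thesis by simp
  qed
  obtain j where j: "j < r" "?m = u j" by (rule Min_attained)
  have "u j = 0" using 0(2) j(2) by simp
  then have "u 0 = 0" using eq[OF j(1)] by simp
  then have "u k = 0" if "k < r" for k using eq[OF that] by simp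
  then have "(\<Sum>k<r. u k) = 0" by (intro sum.neutral) auto
  then show False using u by (simp add: std_simplex_def)
qed

lemma sphere_coord_in_nsphere:
  assumes u: "u \<in> std_simplex r"
  shows "sphere_coord r u \<in> topspace (nsphere (r - 1))"
proof -
  define m where "m = Min (u ` {..<r})"
  define D where "D = (\<Sum>k<r. (u k - u 0)\<^sup>2) + m\<^sup>2"
  have D: "D > 0" unfolding D_def m_def by (rule sphere_denom_pos[OF u])
  have sq: "(sphere_coord r u i)\<^sup>2
      = (if i = 0 then (1 - 2 * m\<^sup>2 / D)\<^sup>2 else 0) + (2 * m / D)\<^sup>2 * (u i - u 0)\<^sup>2" if "i < r" for i
    using that by (simp add: sphere_coord_def Let_def m_def D_def power_mult_distrib power_divide)
  have "(\<Sum>i\<le>r - 1. (sphere_coord r u i)\<^sup>2) = (\<Sum>i<r. (sphere_coord r u i)\<^sup>2)"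
    using r by (intro sum.cong) auto
  also have "\<dots> = (\<Sum>i<r. (if i = 0 then (1 - 2 * m\<^sup>2 / D)\<^sup>2 else 0) + (2 * m / D)\<^sup>2 * (u i - u 0)\<^sup>2)"
    by (intro sum.cong) (auto simp: sq)
  also have "\<dots> = (1 - 2 * m\<^sup>2 / D)\<^sup>2 + (2 * m / D)\<^sup>2 * (D - m\<^sup>2)"
    using r by (simp add: sum.distrib sum_distrib_left[symmetric] D_def)
  also have "\<dots> = 1"
    using D by (simp add: field_simps power2_eq_square)
  finally have "(\<Sum>i\<le>r - 1. (sphere_coord r u i)\<^sup>2) = 1" .
  moreover have "sphere_coord r u i = 0" if "i > r - 1" for i
    using that r by (auto simp: sphere_coord_def Let_def)
  ultimately show ?thesis by (simp add: nsphere)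
qed

lemma sphere_coord_base:
  assumes "Min (u ` {..<r}) = 0"
  shows "sphere_coord r u = (\<lambda>k. if k = 0 then 1 else 0)"
  using assms by (auto simp: sphere_coord_def fun_eq_iff)

lemma sphere_coord_0_less:
  assumes u: "u \<in> std_simplex r" and "0 < Min (u ` {..<r})"
  shows "sphere_coord r u 0 < 1"
  using assms(2) sphere_denom_pos[OF u] by (simp add: sphere_coord_def Let_def)

text \<open>
  Stereographic projection recovers the point \<open>z\<close> of Euclidean space from the point of the sphere.
\<close>

lemma sphere_coord_ratio:
  assumes u: "u \<in> std_simplex r" and m: "0 < Min (u ` {..<r})" and i: "i < r"
  shows "u i - u 0 = Min (u ` {..<r}) * (if i = 0 then 0 else sphere_coord r u i / (1 - sphere_coord r u 0))"
  using m sphere_denom_pos[OF u] i by (simp add: sphere_coord_def Let_def power2_eq_square)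

text \<open>
  Since the smallest coordinate of \<open>u\<close> is \<open>m\<close>, the point \<open>z\<close> determines \<open>u i / m = 1 + z i - min z\<close>.
  So \<open>u\<close> and \<open>u'\<close> are proportional, hence equal because both have sum one.
\<close>

lemma sphere_coord_inj:
  assumes u: "u \<in> std_simplex r" "0 < Min (u ` {..<r})"
    and u': "u' \<in> std_simplex r" "0 < Min (u' ` {..<r})"
    and eq: "sphere_coord r u = sphere_coord r u'" and i: "i < r"
  shows "u i = u' i"
proof -
  define m m' where "m = Min (u ` {..<r})" and "m' = Min (u' ` {..<r})"
  define z where "z i = (if i = 0 then 0 else sphere_coord r u i / (1 - sphere_coord r u 0))" for i
  have z: "u i = u 0 + m * z i" "u' i = u' 0 + m' * z i" if "i < r" for i
    using sphere_coord_ratio[OF u that] sphere_coord_ratio[OF u' that] unfolding z_def eq m_def m'_def by auto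
  \<comment> \<open>The point \<open>z\<close> fixes the offset \<open>v 0 / n\<close> through the condition that the minimum of \<open>v\<close> is \<open>n\<close>.\<close>
  have min: "v 0 = n * (1 - Min (z ` {..<r}))"
    if "n > 0" "n = Min (v ` {..<r})" "\<And>i. i < r \<Longrightarrow> v i = v 0 + n * z i" for n v
  proof (rule antisym)
    obtain j where j: "j < r" "Min (z ` {..<r}) = z j" by (rule Min_attained)
    obtain l where l: "l < r" "Min (v ` {..<r}) = v l" by (rule Min_attained)
    have "n * z j \<le> n * z l" using j l Min_le_coord[of l z] that(1) by (intro mult_left_mono) auto
    moreover have "n = v 0 + n * z l" using that(2) l(2) that(3)[OF l(1)] by linarith
    moreover have *: "n * (1 - Min (z ` {..<r})) = n - n * z j" unfolding j(2) by (simp add: algebra_simps)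
    ultimately show "v 0 \<le> n * (1 - Min (z ` {..<r}))" by linarith
    have "n \<le> v 0 + n * z j" using Min_le_coord[OF j(1), of v] that(2) that(3)[OF j(1)] by linarith
    with * show "n * (1 - Min (z ` {..<r})) \<le> v 0" by linarith
  qed
  define b where "b i = 1 + z i - Min (z ` {..<r})" for i
  have u0: "u 0 = m * (1 - Min (z ` {..<r}))" "u' 0 = m' * (1 - Min (z ` {..<r}))"
    using min[OF _ m_def z(1)] min[OF _ m'_def z(2)] u(2) u'(2) by (simp_all add: m_def m'_def)
  have ub: "u i = m * b i" "u' i = m' * b i" if "i < r" for i
    unfolding z[OF that] unfolding u0 b_def by (simp_all add: algebra_simps)
  have "m * (\<Sum>i<r. b i) = (\<Sum>i<r. u i)" "m' * (\<Sum>i<r. b i) = (\<Sum>i<r. u' i)"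
    unfolding sum_distrib_left by (intro sum.cong; simp add: ub)+
  then have "m * (\<Sum>i<r. b i) = 1" "m' * (\<Sum>i<r. b i) = 1"
    using u u' by (simp_all add: std_simplex_def)
  then have "m = m'"
    by (metis mult_cancel_right mult_zero_right zero_neq_one)
  then show ?thesis using ub[OF i] by simp
qed

text \<open>
  The preimage is found by running the two homeomorphisms backwards: stereographic projection gives
  \<open>z\<close>, and \<open>u\<close> is the multiple of \<open>1 + z i - min z\<close> that has coordinate sum one.
\<close>

lemma sphere_coord_surj:
  assumes y: "y \<in> topspace (nsphere (r - 1))" and ne: "y \<noteq> (\<lambda>k. if k = 0 then 1 else 0)"
  obtains u where "u \<in> std_simplex r" "0 < Min (u ` {..<r})" "sphere_coord r u = y"
proof -
  have "{..r - 1} = {..<r}" using r by auto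
  then have sum1: "(\<Sum>i<r. (y i)\<^sup>2) = 1" and out: "\<And>i. i \<ge> r \<Longrightarrow> y i = 0"
    using y r by (auto simp: nsphere)
  have split: "(\<Sum>i<r. f i) = f 0 + (\<Sum>i\<in>{..<r} - {0}. f i)" for f :: "nat \<Rightarrow> real"
    using r by (intro sum.remove) auto
  have rest: "(\<Sum>i\<in>{..<r} - {0}. (y i)\<^sup>2) = 1 - (y 0)\<^sup>2"
    using split[of "\<lambda>i. (y i)\<^sup>2"] sum1 by simp
  moreover have "0 \<le> (\<Sum>i\<in>{..<r} - {0}. (y i)\<^sup>2)" by (intro sum_nonneg) simp
  ultimately have "(y 0)\<^sup>2 \<le> 1" by linarith
  then have "y 0 \<le> 1" by (simp add: abs_square_le_1)
  moreover have "y 0 \<noteq> 1"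
  proof
    assume y0: "y 0 = 1"
    then have "(\<Sum>i\<in>{..<r} - {0}. (y i)\<^sup>2) = 0" using rest by simp
    then have "\<forall>i\<in>{..<r} - {0}. (y i)\<^sup>2 = 0" by (simp add: sum_nonneg_eq_0_iff)
    then have "y i = 0" if "i \<noteq> 0" for i using that out[of i] by (cases "i < r") auto
    then show False using y0 ne by auto
  qed
  ultimately have y0: "y 0 < 1" by simp
  define z where "z i = (if i = 0 then 0 else y i / (1 - y 0))" for i
  define b where "b i = 1 + z i - Min (z ` {..<r})" for i
  define S where "S = (\<Sum>i<r. b i)"
  define u where "u i = b i / S" for i
  have b1: "1 \<le> b i" if "i < r" for i using Min_le_coord[OF that, of z] by (simp add: b_def)
  then have "(\<Sum>i<r. 1) \<le> S" unfolding S_def by (intro sum_mono) auto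
  then have S: "S > 0" using r by simp
  obtain j where j: "j < r" "Min (z ` {..<r}) = z j" by (rule Min_attained)
  have "Min (u ` {..<r}) = u j"
    using j Min_le_coord[of _ z] S by (intro Min_eqI) (auto simp: u_def b_def divide_right_mono)
  then have m: "Min (u ` {..<r}) = 1 / S" using j by (simp add: u_def b_def)
  have w: "u i - u 0 = z i / S" for i
    by (simp add: u_def b_def z_def diff_divide_distrib[symmetric])
  have "(\<Sum>i<r. (z i)\<^sup>2) = (\<Sum>i\<in>{..<r} - {0}. (y i)\<^sup>2 / (1 - y 0)\<^sup>2)"
    unfolding split by (simp add: z_def power_divide)
  also have "\<dots> = (1 - (y 0)\<^sup>2) / (1 - y 0)\<^sup>2"
    by (simp add: rest flip: sum_divide_distrib)
  also have "\<dots> = (1 + y 0) / (1 - y 0)"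
    using y0 by (simp add: divide_simps) (simp add: algebra_simps power2_eq_square)
  finally have zz: "(\<Sum>i<r. (z i)\<^sup>2) = (1 + y 0) / (1 - y 0)" .
  have "(\<Sum>k<r. (u k - u 0)\<^sup>2) + (Min (u ` {..<r}))\<^sup>2 = (\<Sum>k<r. (z k)\<^sup>2) / S\<^sup>2 + 1 / S\<^sup>2"
    by (simp add: w m power_divide sum_divide_distrib)
  also have "\<dots> = 2 / ((1 - y 0) * S\<^sup>2)"
    unfolding zz using S y0 by (simp add: divide_simps)
  finally have D: "(\<Sum>k<r. (u k - u 0)\<^sup>2) + (Min (u ` {..<r}))\<^sup>2 = 2 / ((1 - y 0) * S\<^sup>2)" .
  have "sphere_coord r u i = y i" for i
  proof -
    have "sphere_coord r u i = (if i = 0 then 1 - 2 * (1 / S)\<^sup>2 / (2 / ((1 - y 0) * S\<^sup>2))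
        else if i < r then 2 * (1 / S) * (z i / S) / (2 / ((1 - y 0) * S\<^sup>2)) else 0)"
      unfolding sphere_coord_def Let_def D unfolding m w by (rule refl)
    also have "\<dots> = y i"
      using S y0 out[of i] by (auto simp: z_def power2_eq_square field_simps)
    finally show ?thesis .
  qed
  moreover have "u \<in> std_simplex r"
  proof -
    have "0 \<le> u k" if "k < r" for k using b1[OF that] S by (simp add: u_def)
    moreover have "(\<Sum>k<r. u k) = 1" using S by (simp add: u_def S_def flip: sum_divide_distrib)
    ultimately show ?thesis by (simp add: std_simplex_def)
  qed
  moreover have "0 < Min (u ` {..<r})" using m S by simp
  ultimately show thesis using that by blast
qed

lemma continuous_on_sphere_coord:
  fixes f :: "'b::topological_space \<Rightarrow> nat \<Rightarrow> real"
  assumes cont: "\<And>k. continuous_on S (\<lambda>x. f x k)" and simplex: "\<And>x. x \<in> S \<Longrightarrow> f x \<in> std_simplex r"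
  shows "continuous_on S (\<lambda>x. sphere_coord r (f x))"
proof (rule continuous_on_coordinatewise_then_product)
  fix i
  have m: "continuous_on S (\<lambda>x. Min (f x ` {..<r}))"
    using r by (intro continuous_on_Min cont) (auto simp: lessThan_empty_iff)
  have ne: "(\<Sum>k<r. (f x k - f x 0)\<^sup>2) + (Min (f x ` {..<r}))\<^sup>2 \<noteq> 0" if "x \<in> S" for x
    using sphere_denom_pos[OF simplex[OF that]] by linarith
  have "continuous_on S (\<lambda>x. 1 - 2 * (Min (f x ` {..<r}))\<^sup>2 
      / ((\<Sum>k<r. (f x k - f x 0)\<^sup>2) + (Min (f x ` {..<r}))\<^sup>2))"
    using ne by (intro continuous_intros m cont) auto
  moreover have "continuous_on S (\<lambda>x. 2 * Min (f x ` {..<r}) * (f x i - f x 0) 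
      / ((\<Sum>k<r. (f x k - f x 0)\<^sup>2) + (Min (f x ` {..<r}))\<^sup>2))"
    using ne by (intro continuous_intros m cont) auto
  ultimately show "continuous_on S (\<lambda>x. sphere_coord r (f x) i)"
    unfolding sphere_coord_def Let_def by (cases "i = 0"; cases "i < r") simp_all
qed

end

section \<open>A skeleton with additional facets\<close>

text \<open>
  The simplices \<open>\<sigma>\<close> with fewer than \<open>r\<close> vertices other than \<open>v0\<close> form a cone with apex \<open>v0\<close> over the
  skeleton of dimension \<open>r - 2\<close> of the remaining simplex. The complex \<open>L\<close> is obtained from this cone
  by attaching the simplices in \<open>Fac\<close>, which have dimension \<open>r - 1\<close> and boundary in the cone.
  Collapsing the cone leaves one sphere for each element of \<open>Fac\<close>.
\<close>

locale skeleton_with_facets =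
  fixes V :: "'a set" and v0 :: 'a and r :: nat and Fac L :: "'a set set"
  assumes finV: "finite V" and v0: "v0 \<in> V" and r: "r \<ge> 1"
    and Fac: "\<And>\<sigma>. \<sigma> \<in> Fac \<Longrightarrow> \<sigma> \<subseteq> V - {v0} \<and> card \<sigma> = r"
    and L: "L = {\<sigma>. \<sigma> \<subseteq> V \<and> card (\<sigma> - {v0}) < r} \<union> Fac"
begin

lemma finFac: "finite Fac"
proof (rule finite_subset)
  show "Fac \<subseteq> Pow V" using Fac by blast
qed (simp add: finV)

lemma L_sub: "L \<subseteq> Pow V"
  unfolding L using Fac by blast

lemma mem_P: "x \<in> realization L \<longleftrightarrow> (\<forall>v. 0 \<le> x v) \<and> {v. x v \<noteq> 0} \<in> L \<and> sum x V = 1"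
  by (rule mem_realization_iff[OF finV L_sub])

lemma down: "\<sigma> \<in> L \<Longrightarrow> \<tau> \<subseteq> \<sigma> \<Longrightarrow> \<tau> \<in> L"
proof -
  assume \<sigma>: "\<sigma> \<in> L" and \<tau>: "\<tau> \<subseteq> \<sigma>"
  have "\<tau> \<subseteq> V" using \<sigma> \<tau> L_sub by blast
  have fin: "finite \<sigma>" using \<sigma> L_sub finV finite_subset by blast
  show "\<tau> \<in> L"
  proof (cases "card (\<sigma> - {v0}) < r")
    case True
    have "card (\<tau> - {v0}) \<le> card (\<sigma> - {v0})" using fin \<tau> by (intro card_mono) auto
    then show ?thesis using True \<open>\<tau> \<subseteq> V\<close> by (simp add: L)
  next
    case False
    then have F: "\<sigma> \<in> Fac" using \<sigma> by (simp add: L)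
    show ?thesis
    proof (cases "\<tau> = \<sigma>")
      case False
      then have "card \<tau> < card \<sigma>" using fin \<tau> by (intro psubset_card_mono) auto
      moreover have "card (\<tau> - {v0}) \<le> card \<tau>" by (rule card_Diff1_le)
      ultimately have "card (\<tau> - {v0}) < r" using Fac[OF F] by simp
      then show ?thesis using \<open>\<tau> \<subseteq> V\<close> by (simp add: L)
    qed (use \<sigma> in simp)
  qed
qed

text \<open>
  On the realization of \<open>L\<close> the height is zero precisely on the cone. On an attached facet it is the
  smallest barycentric coordinate, so it measures the distance from the boundary.
\<close>

definition height :: "('a \<Rightarrow> real) \<Rightarrow> real" where
  "height = kth_largest r (V - {v0})"

lemma finB: "finite (V - {v0})" using finV by simp

lemma height_nonneg: "0 \<le> height x"
  unfolding height_def by (rule kth_largest_nonneg[OF finB r])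

lemma supp_Int:
  assumes "x \<in> realization L" shows "{v. x v \<noteq> 0} \<inter> (V - {v0}) = {v. x v \<noteq> 0} - {v0}"
  using assms L_sub by (auto simp: mem_P)

lemma height_eq_0_iff:
  assumes x: "x \<in> realization L"
  shows "height x = 0 \<longleftrightarrow> card ({v. x v \<noteq> 0} - {v0}) < r"
proof
  assume "height x = 0"
  then have "\<not> r \<le> card ({v. x v \<noteq> 0} \<inter> (V - {v0}))"
    using kth_largest_pos[OF finB r, of x] x unfolding height_def by (auto simp: mem_P)
  then show "card ({v. x v \<noteq> 0} - {v0}) < r" by (simp add: supp_Int[OF x])
next
  assume "card ({v. x v \<noteq> 0} - {v0}) < r"
  then show "height x = 0"
    unfolding height_def using x
    by (intro kth_largest_eq_0[OF finB r]) (auto simp: supp_Int[OF x] mem_P)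
qed

lemma height_eq_Min:
  assumes x: "x \<in> realization L" and \<sigma>: "\<sigma> \<in> Fac" "{v. x v \<noteq> 0} \<subseteq> \<sigma>"
  shows "height x = Min (x ` \<sigma>)"
  unfolding height_def using Fac[OF \<sigma>(1)] \<sigma>(2) x
  by (intro kth_largest_eq_Min[OF finB r]) (auto simp: mem_P)

lemma supp_in_Fac:
  assumes x: "x \<in> realization L" and "height x \<noteq> 0"
  shows "{v. x v \<noteq> 0} \<in> Fac"
proof -
  have "{v. x v \<noteq> 0} \<in> L" using x by (simp add: mem_P)
  moreover have "\<not> card ({v. x v \<noteq> 0} - {v0}) < r" using assms(2) height_eq_0_iff[OF x] by simp
  ultimately show ?thesis by (simp add: L)
qed

lemma Fac_finite_nonempty:
  assumes "\<sigma> \<in> Fac" shows "finite \<sigma>" "\<sigma> \<noteq> {}"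
  using Fac[OF assms] r finV by (auto intro: card_ge_0_finite)

lemma supp_eq_facet:
  assumes x: "x \<in> realization L" and \<sigma>: "\<sigma> \<in> Fac" "{v. x v \<noteq> 0} \<subseteq> \<sigma>" and h: "height x \<noteq> 0"
  shows "{v. x v \<noteq> 0} = \<sigma>"
proof (intro equalityI subsetI)
  fix v assume v: "v \<in> \<sigma>"
  have "height x \<le> x v" unfolding height_eq_Min[OF x \<sigma>]
    using v Fac_finite_nonempty[OF \<sigma>(1)] by (intro Min_le) auto
  then show "v \<in> {v. x v \<noteq> 0}" using h height_nonneg[of x] by auto
qed (use \<sigma> in blast)

lemma continuous_on_height:
  assumes "\<And>v. continuous_on S (\<lambda>z. f z v)"
  shows "continuous_on S (\<lambda>z. height (f z))"
  unfolding height_def by (rule continuous_on_kth_largest[OF finB r assms])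

text \<open>
  The map \<open>shrink\<close> extends the straight-line contraction of the cone to \<open>v0\<close> to a homotopy of the
  whole realization. On the cone, \<open>cutoff\<close> is zero and \<open>drift\<close> is the time \<open>t\<close>. On an attached facet,
  the points of height at most \<open>t / (2 * r)\<close> form a collar of the boundary. The part above the collar
  is expanded to the whole facet, by subtracting \<open>t / (2 * r)\<close> from all coordinates and rescaling.
  A point in the collar is pushed to the boundary, by subtracting its height and rescaling, and then
  moved towards \<open>v0\<close> for the time \<open>drift\<close>, which grows from \<open>0\<close> at the top of the collar to \<open>t\<close> at
  the boundary. The factor \<open>2\<close> keeps the collar away from the barycentre, whose height is \<open>1 / r\<close>.
\<close>

definition cutoff :: "real \<Rightarrow> ('a \<Rightarrow> real) \<Rightarrow> real" where
  "cutoff t x = min (height x) (t / (2 * real r))"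

definition drift :: "real \<Rightarrow> ('a \<Rightarrow> real) \<Rightarrow> real" where
  "drift t x = max 0 (t - 2 * real r * height x)"

definition shrink :: "real \<times> ('a \<Rightarrow> real) \<Rightarrow> 'a \<Rightarrow> real" where
  "shrink = (\<lambda>(t, x) v. (1 - drift t x) * (max 0 (x v - cutoff t x) / (1 - real r * cutoff t x))
      + drift t x * (if v = v0 then 1 else 0))"

lemma cutoff_bound: "t \<in> {0..1} \<Longrightarrow> 1 - real r * cutoff t x > 0"
proof -
  assume t: "t \<in> {0..1}"
  have "real r * cutoff t x \<le> real r * (t / (2 * real r))"
    by (intro mult_left_mono) (auto simp: cutoff_def)
  also have "\<dots> = t / 2" using r by simp
  finally show ?thesis using t by simp
qed

lemma drift_bounds: "t \<in> {0..1} \<Longrightarrow> 0 \<le> drift t x \<and> drift t x \<le> 1"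
  using height_nonneg[of x] by (auto simp: drift_def intro: order_trans[of _ t])

lemma shrink_height_0:
  assumes "t \<in> {0..1}" "x \<in> realization L" "height x = 0"
  shows "shrink (t, x) v = (1 - t) * x v + t * (if v = v0 then 1 else 0)"
proof -
  have "cutoff t x = 0" "drift t x = t" using assms by (simp_all add: cutoff_def drift_def)
  then show ?thesis using assms by (simp add: shrink_def mem_P)
qed

lemma shrink_nonneg:
  assumes "t \<in> {0..1}"
  shows "0 \<le> shrink (t, x) v"
  using cutoff_bound[OF assms, of x] drift_bounds[OF assms, of x]
  by (auto simp: shrink_def intro!: add_nonneg_nonneg mult_nonneg_nonneg divide_nonneg_pos)

lemma shrink_height_0_mem:
  assumes t: "t \<in> {0..1}" and x: "x \<in> realization L" and h: "height x = 0"
  shows "shrink (t, x) \<in> realization L" "height (shrink (t, x)) = 0"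
proof -
  note sh = shrink_height_0[OF t x h]
  have suppV: "{v. x v \<noteq> 0} \<subseteq> V" using x L_sub by (auto simp: mem_P)
  then have fin: "finite {v. x v \<noteq> 0}" using finV finite_subset by blast
  have sub: "{v. shrink (t, x) v \<noteq> 0} - {v0} \<subseteq> {v. x v \<noteq> 0} - {v0}" by (auto simp: sh)
  have "card ({v. shrink (t, x) v \<noteq> 0} - {v0}) \<le> card ({v. x v \<noteq> 0} - {v0})"
    using sub fin by (intro card_mono) auto
  then have small: "card ({v. shrink (t, x) v \<noteq> 0} - {v0}) < r" using h height_eq_0_iff[OF x] by simp
  have "{v. shrink (t, x) v \<noteq> 0} \<subseteq> V" using sub suppV v0 by blast
  then have "{v. shrink (t, x) v \<noteq> 0} \<in> L" using small by (simp add: L)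
  moreover have "sum (shrink (t, x)) V = 1"
  proof -
    have "sum (shrink (t, x)) V = (1 - t) * sum x V + t * (\<Sum>v\<in>V. if v = v0 then 1 else 0)"
      by (simp add: sh sum.distrib sum_distrib_left)
    also have "\<dots> = 1" using x v0 finV by (simp add: mem_P)
    finally show ?thesis .
  qed
  ultimately show mem: "shrink (t, x) \<in> realization L"
    using shrink_nonneg[OF t] by (simp add: mem_P)
  show "height (shrink (t, x)) = 0" using small height_eq_0_iff[OF mem] by simp
qed

text \<open>
  The case of interest is a point in the interior of an attached facet \<open>\<sigma>\<close>. If it does not drift, it
  stays in \<open>\<sigma>\<close>. If it drifts, then its height was subtracted from all coordinates, so a coordinate
  vanished and fewer than \<open>r\<close> vertices remain besides \<open>v0\<close>.
\<close>

lemma shrink_mem: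
  assumes t: "t \<in> {0..1}" and x: "x \<in> realization L"
  shows "shrink (t, x) \<in> realization L"
proof (cases "height x = 0")
  case True
  then show ?thesis using shrink_height_0_mem[OF t x] by simp
next
  case False
  define \<sigma> where "\<sigma> = {v. x v \<noteq> 0}"
  have \<sigma>: "\<sigma> \<in> Fac" unfolding \<sigma>_def by (rule supp_in_Fac[OF x False])
  note fin = Fac_finite_nonempty[OF \<sigma>]
  have \<sigma>V: "\<sigma> \<subseteq> V" "card \<sigma> = r" using Fac[OF \<sigma>] by auto
  have x0: "x v = 0" if "v \<notin> \<sigma>" for v using that by (simp add: \<sigma>_def)
  have hMin: "height x = Min (x ` \<sigma>)" using height_eq_Min[OF x \<sigma>] by (simp add: \<sigma>_def)
  then have hle: "height x \<le> x v" if "v \<in> \<sigma>" for v using that fin by simp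
  define u where "u = cutoff t x"
  have u: "0 \<le> u" "u \<le> height x" using t height_nonneg[of x] by (auto simp: u_def cutoff_def)
  have sum\<sigma>: "(\<Sum>v\<in>\<sigma>. x v) = 1"
  proof -
    have "(\<Sum>v\<in>\<sigma>. x v) = sum x V" using \<sigma>V finV x0 by (intro sum.mono_neutral_left) auto
    then show ?thesis using x by (simp add: mem_P)
  qed
  have "(\<Sum>v\<in>V. max 0 (x v - u)) = (\<Sum>v\<in>\<sigma>. max 0 (x v - u))"
    using \<sigma>V finV x0 u by (intro sum.mono_neutral_right) auto
  also have "\<dots> = (\<Sum>v\<in>\<sigma>. x v - u)"
  proof (intro sum.cong refl)
    fix v assume "v \<in> \<sigma>"
    then show "max 0 (x v - u) = x v - u" using hle[of v] u by simp
  qed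
  also have "\<dots> = 1 - real r * u" using sum\<sigma> \<sigma>V by (simp add: sum_subtractf)
  finally have "(\<Sum>v\<in>V. max 0 (x v - u) / (1 - real r * u)) = 1"
    using cutoff_bound[OF t, of x] by (simp add: u_def flip: sum_divide_distrib)
  moreover have "(\<Sum>v\<in>V. if v = v0 then 1 else 0 :: real) = 1" using v0 finV by simp
  moreover have "sum (shrink (t, x)) V = (1 - drift t x) * (\<Sum>v\<in>V. max 0 (x v - u) / (1 - real r * u))
      + drift t x * (\<Sum>v\<in>V. if v = v0 then 1 else 0)"
    by (simp only: shrink_def case_prod_conv sum.distrib sum_distrib_left u_def)
  ultimately have sum1: "sum (shrink (t, x)) V = 1" by simp
  have above: "v \<in> \<sigma> \<and> u < x v" if "shrink (t, x) v \<noteq> 0" "v \<noteq> v0 \<or> drift t x = 0" for v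
  proof -
    have "max 0 (x v - u) \<noteq> 0" using that by (auto simp: shrink_def u_def)
    then have "u < x v" by (auto simp: max_def split: if_splits)
    then show ?thesis using u x0[of v] by auto
  qed
  have "{v. shrink (t, x) v \<noteq> 0} \<in> L"
  proof (cases "drift t x = 0")
    case True
    have "{v. shrink (t, x) v \<noteq> 0} \<subseteq> \<sigma>" using above True by blast
    moreover have "\<sigma> \<in> L" using \<sigma> by (simp add: L)
    ultimately show ?thesis using down by blast
  next
    case False
    then have "2 * real r * height x < t" by (auto simp: drift_def)
    then have "height x < t / (2 * real r)" using r by (simp add: pos_less_divide_eq mult.commute mult.left_commute)
    then have uh: "u = height x" by (simp add: u_def cutoff_def)
    have "height x \<in> x ` \<sigma>" unfolding hMin using fin by (intro Min_in) auto
    then obtain w where w: "w \<in> \<sigma>" "height x = x w" by blast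
    have sub: "{v. shrink (t, x) v \<noteq> 0} - {v0} \<subseteq> \<sigma> - {w}"
      using above uh w by auto
    then have "card ({v. shrink (t, x) v \<noteq> 0} - {v0}) \<le> card (\<sigma> - {w})"
      using fin by (intro card_mono) auto
    also have "\<dots> < r" using w fin \<sigma>V card_Diff1_less[of \<sigma> w] by simp
    finally show ?thesis using sub \<sigma>V v0 by (auto simp: L)
  qed
  then show ?thesis using sum1 shrink_nonneg[OF t] by (simp add: mem_P)
qed

lemma shrink_0: "x \<in> realization L \<Longrightarrow> shrink (0, x) = x"
  using height_nonneg[of x] by (auto simp: shrink_def cutoff_def drift_def mem_P)

lemma continuous_on_shrink: "continuous_on ({0..1} \<times> realization L) shrink"
proof (rule continuous_on_coordinatewise_then_product)
  fix v
  let ?S = "{0..1} \<times> realization L"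
  have coord: "continuous_on ?S (\<lambda>z. snd z v)" for v
    by (rule continuous_on_product_then_coordinatewise) (intro continuous_intros)
  have h: "continuous_on ?S (\<lambda>z. height (snd z))" by (rule continuous_on_height[OF coord])
  have cut: "continuous_on ?S (\<lambda>z. cutoff (fst z) (snd z))"
    unfolding cutoff_def using r by (intro continuous_intros h) auto
  have dr: "continuous_on ?S (\<lambda>z. drift (fst z) (snd z))"
    unfolding drift_def by (intro continuous_intros h)
  have "1 - real r * cutoff (fst z) (snd z) \<noteq> 0" if "z \<in> ?S" for z
    using cutoff_bound[of "fst z" "snd z"] that by auto
  then show "continuous_on ?S (\<lambda>z. shrink z v)"
    unfolding shrink_def case_prod_unfold by (intro continuous_intros coord cut dr) auto
qed

abbreviation base :: "nat \<Rightarrow> real" where "base \<equiv> \<lambda>k. if k = 0 then 1 else 0"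

text \<open>
  The quotient map \<open>q\<close> sends the cone to the base point and each attached facet onto its own sphere
  by \<open>sphere_coord\<close>, after a numbering \<open>idx\<close> of the facets and numberings \<open>e\<close> of their vertices. Its
  nontrivial fibre is the cone, which \<open>shrink\<close> keeps invariant and finally contracts to \<open>v0\<close>.
\<close>

lemma skeleton_homotopy_equivalent_wedge:
  "geometric_realization L homotopy_equivalent_space wedge_of_spheres (card Fac) (r - 1)"
proof -
  let ?P = "realization L" and ?W = "wedge_of_spheres (card Fac) (r - 1)"
  obtain idx where idx: "bij_betw idx Fac {..<card Fac}"
    using ex_bij_betw_finite_nat[OF finFac] by (auto simp: atLeast0LessThan)
  have "\<exists>e. bij_betw e {..<r} \<sigma>" if "\<sigma> \<in> Fac" for \<sigma>
    using ex_bij_betw_nat_finite[OF Fac_finite_nonempty(1)[OF that]] Fac[OF that]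
    by (auto simp: atLeast0LessThan)
  then obtain e where e: "\<And>\<sigma>. \<sigma> \<in> Fac \<Longrightarrow> bij_betw (e \<sigma>) {..<r} \<sigma>" by metis
  define chart where "chart \<sigma> x = sphere_coord r (\<lambda>k. x (e \<sigma> k))" for \<sigma> and x :: "'a \<Rightarrow> real"
  define q where "q x = (if height x = 0 then None else Some (idx {v. x v \<noteq> 0}, chart {v. x v \<noteq> 0} x))" for x
  have coords: "(\<lambda>k. x (e \<sigma> k)) \<in> std_simplex r" "height x = Min ((\<lambda>k. x (e \<sigma> k)) ` {..<r})"
    if x: "x \<in> ?P" and \<sigma>: "\<sigma> \<in> Fac" "{v. x v \<noteq> 0} \<subseteq> \<sigma>" for x \<sigma>
  proof -
    have img: "e \<sigma> ` {..<r} = \<sigma>" using e[OF \<sigma>(1)] by (simp add: bij_betw_def)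
    have "(\<lambda>k. x (e \<sigma> k)) ` {..<r} = x ` \<sigma>" using image_image[of x "e \<sigma>" "{..<r}"] img by simp
    then show "height x = Min ((\<lambda>k. x (e \<sigma> k)) ` {..<r})" using height_eq_Min[OF x \<sigma>] by simp
    have "(\<Sum>k<r. x (e \<sigma> k)) = sum x \<sigma>" by (rule sum.reindex_bij_betw[OF e[OF \<sigma>(1)]])
    also have "\<dots> = sum x V"
      using \<sigma>(2) Fac[OF \<sigma>(1)] finV by (intro sum.mono_neutral_left) auto
    also have "\<dots> = 1" using x by (simp add: mem_P)
    finally show "(\<lambda>k. x (e \<sigma> k)) \<in> std_simplex r" using x by (simp add: std_simplex_def mem_P)
  qed
  have chart_base: "chart \<sigma> x = base \<longleftrightarrow> height x = 0"
    if x: "x \<in> ?P" and \<sigma>: "\<sigma> \<in> Fac" "{v. x v \<noteq> 0} \<subseteq> \<sigma>" for x \<sigma>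
  proof
    assume "height x = 0"
    then show "chart \<sigma> x = base"
      unfolding chart_def using coords(2)[OF that] by (intro sphere_coord_base[OF r]) simp
  next
    assume eq: "chart \<sigma> x = base"
    show "height x = 0"
    proof (rule ccontr)
      assume "height x \<noteq> 0"
      then have "0 < Min ((\<lambda>k. x (e \<sigma> k)) ` {..<r})"
        using coords(2)[OF that] height_nonneg[of x] by simp
      then have "chart \<sigma> x 0 < 1"
        unfolding chart_def by (rule sphere_coord_0_less[OF r coords(1)[OF that]])
      then show False by (simp add: eq)
    qed
  qed
  have q_eq: "q x = wedge_map (\<lambda>_. base) (idx \<sigma>) (chart \<sigma> x)"
    if x: "x \<in> ?P" and \<sigma>: "\<sigma> \<in> Fac" "{v. x v \<noteq> 0} \<subseteq> \<sigma>" for x \<sigma>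
    using chart_base[OF that] supp_eq_facet[OF that] by (simp add: q_def wedge_map_def)
  have q_None: "q x = None \<longleftrightarrow> height x = 0" for x by (simp add: q_def)
  have base_sphere: "base \<in> topspace (nsphere (r - 1))"
    by (simp add: nsphere if_distrib[of "\<lambda>x. x\<^sup>2"] cong: if_cong)
  have W_top: "topspace ?W = insert None (\<Union>i\<in>{..<card Fac}. wedge_map (\<lambda>_. base) i ` topspace (nsphere (r - 1)))"
    by (simp add: wedge_of_spheres_def topspace_wedge_topology)
  have W_Haus: "Hausdorff_space ?W"
    unfolding wedge_of_spheres_def
  proof (rule Hausdorff_space_wedge_topology)
    show "Hausdorff_space (nsphere (r - 1))"
      unfolding nsphere by (intro Hausdorff_space_subtopology) (simp add: Hausdorff_space_product_topology)
  qed (rule base_sphere)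
  have idx_less: "idx \<sigma> < card Fac" if "\<sigma> \<in> Fac" for \<sigma>
    using idx that by (auto simp: bij_betw_def)
  have coord: "continuous_on S (\<lambda>x. x v)" for S :: "('a \<Rightarrow> real) set" and v
    by (rule continuous_on_product_then_coordinatewise) (rule continuous_on_id)
  \<comment> \<open>The realization is covered by finitely many closed sets, the cone and the facets, on each of
     which \<open>q\<close> has a continuous description.\<close>
  define T where "T i = ?P \<inter> (case i of None \<Rightarrow> {x. height x = 0} | Some \<sigma> \<Rightarrow> (\<Inter>v\<in>- \<sigma>. {x. x v = 0}))" for i
  have T_Some: "x \<in> T (Some \<sigma>) \<longleftrightarrow> x \<in> ?P \<and> {v. x v \<noteq> 0} \<subseteq> \<sigma>" for x \<sigma> by (auto simp: T_def)
  have T_None: "x \<in> T None \<longleftrightarrow> x \<in> ?P \<and> height x = 0" for x by (auto simp: T_def)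
  have q_cont: "continuous_map (top_of_set ?P) ?W q"
  proof (rule pasting_lemma_closed[where I = "insert None (Some ` Fac)" and T = T
        and f = "\<lambda>i x. case i of None \<Rightarrow> None | Some \<sigma> \<Rightarrow> wedge_map (\<lambda>_. base) (idx \<sigma>) (chart \<sigma> x)"])
    show "finite (insert None (Some ` Fac))" using finFac by simp
  next
    fix i assume "i \<in> insert None (Some ` Fac)"
    have "closed {x. height x = 0}"
      by (intro closed_Collect_eq continuous_on_height coord continuous_on_const)
    moreover have "closed (\<Inter>v\<in>- \<sigma>. {x :: 'a \<Rightarrow> real. x v = 0})" for \<sigma>
      by (intro closed_INT ballI closed_Collect_eq coord continuous_on_const)
    ultimately show "closedin (top_of_set ?P) (T i)"
      unfolding T_def by (cases i) (auto intro!: closedin_closed_Int)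
  next
    fix i assume i: "i \<in> insert None (Some ` Fac)"
    have sub: "subtopology (top_of_set ?P) (T i) = top_of_set (T i)"
      by (simp add: subtopology_subtopology T_def Int_assoc[symmetric])
    show "continuous_map (subtopology (top_of_set ?P) (T i)) ?W
        (\<lambda>x. case i of None \<Rightarrow> None | Some \<sigma> \<Rightarrow> wedge_map (\<lambda>_. base) (idx \<sigma>) (chart \<sigma> x))"
    proof (cases i)
      case None
      moreover have "None \<in> topspace ?W" unfolding W_top by blast
      ultimately show ?thesis by simp
    next
      case (Some \<sigma>)
      then have \<sigma>: "\<sigma> \<in> Fac" using i by auto
      have simp: "(\<lambda>k. x (e \<sigma> k)) \<in> std_simplex r" if "x \<in> T (Some \<sigma>)" for x
        using coords(1)[OF _ \<sigma>] that by (simp add: T_Some)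
      have "continuous_on (T (Some \<sigma>)) (chart \<sigma>)"
        unfolding chart_def by (rule continuous_on_sphere_coord[OF r coord simp])
      moreover have "chart \<sigma> x \<in> topspace (nsphere (r - 1))" if "x \<in> T (Some \<sigma>)" for x
        unfolding chart_def by (rule sphere_coord_in_nsphere[OF r simp[OF that]])
      ultimately have "continuous_map (top_of_set (T (Some \<sigma>))) (nsphere (r - 1)) (chart \<sigma>)"
        by (auto simp: nsphere euclidean_product_topology)
      moreover have "continuous_map (nsphere (r - 1)) ?W (wedge_map (\<lambda>_. base) (idx \<sigma>))"
        unfolding wedge_of_spheres_def using idx_less[OF \<sigma>]
        by (intro continuous_map_wedge_map[where X = "\<lambda>_. nsphere (r - 1)"]) simp
      ultimately show ?thesis
        unfolding sub unfolding Some using continuous_map_compose by (fastforce simp: comp_def)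
    qed
  next
    have q_f: "q x = (case i of None \<Rightarrow> None | Some \<sigma> \<Rightarrow> wedge_map (\<lambda>_. base) (idx \<sigma>) (chart \<sigma> x))"
      if "i \<in> insert None (Some ` Fac)" "x \<in> T i" for i x
      using that by (cases i) (auto simp: T_None T_Some q_None q_eq)
    show "(case i of None \<Rightarrow> None | Some \<sigma> \<Rightarrow> wedge_map (\<lambda>_. base) (idx \<sigma>) (chart \<sigma> x))
        = (case j of None \<Rightarrow> None | Some \<sigma> \<Rightarrow> wedge_map (\<lambda>_. base) (idx \<sigma>) (chart \<sigma> x))"
      if "i \<in> insert None (Some ` Fac)" "j \<in> insert None (Some ` Fac)"
        "x \<in> topspace (top_of_set ?P) \<inter> T i \<inter> T j" for i j x
    proof -
      have "x \<in> T i" "x \<in> T j" using that(3) by blast+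
      from q_f[OF that(1) this(1)] q_f[OF that(2) this(2)] show ?thesis by (rule trans[OF sym])
    qed
    show "\<exists>j. j \<in> insert None (Some ` Fac) \<and> x \<in> T j \<and>
        q x = (case j of None \<Rightarrow> None | Some \<sigma> \<Rightarrow> wedge_map (\<lambda>_. base) (idx \<sigma>) (chart \<sigma> x))"
      if "x \<in> topspace (top_of_set ?P)" for x
    proof -
      have x: "x \<in> ?P" using that by simp
      have "\<exists>j. j \<in> insert None (Some ` Fac) \<and> x \<in> T j"
      proof (cases "height x = 0")
        case True
        then show ?thesis using x by (intro exI[of _ None]) (simp add: T_None)
      next
        case False
        then show ?thesis using supp_in_Fac[OF x] x
          by (intro exI[of _ "Some {v. x v \<noteq> 0}"]) (simp add: T_Some)
      qed
      then show ?thesis using q_f by blast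
    qed
  qed
  have q_inj: "x = y" if x: "x \<in> ?P" and y: "y \<in> ?P" and eq: "q x = q y" and h: "height x \<noteq> 0" for x y
  proof -
    have hy: "height y \<noteq> 0" using q_None[of x] q_None[of y] eq h by simp
    define \<sigma> where "\<sigma> = {v. x v \<noteq> 0}"
    have \<sigma>: "\<sigma> \<in> Fac" unfolding \<sigma>_def by (rule supp_in_Fac[OF x h])
    have "idx {v. x v \<noteq> 0} = idx {v. y v \<noteq> 0}" and c: "chart {v. x v \<noteq> 0} x = chart {v. y v \<noteq> 0} y"
      using eq h hy by (simp_all add: q_def)
    then have \<sigma>y: "{v. y v \<noteq> 0} = \<sigma>"
      using idx supp_in_Fac[OF x h] supp_in_Fac[OF y hy] unfolding \<sigma>_def bij_betw_def inj_on_def by metis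
    have c: "sphere_coord r (\<lambda>k. x (e \<sigma> k)) = sphere_coord r (\<lambda>k. y (e \<sigma> k))"
      using c \<sigma>y by (simp add: chart_def \<sigma>_def)
    have sx: "{v. x v \<noteq> 0} \<subseteq> \<sigma>" and sy: "{v. y v \<noteq> 0} \<subseteq> \<sigma>" using \<sigma>y by (simp_all add: \<sigma>_def)
    have "0 < Min ((\<lambda>k. x (e \<sigma> k)) ` {..<r})" "0 < Min ((\<lambda>k. y (e \<sigma> k)) ` {..<r})"
      using coords(2)[OF x \<sigma> sx] coords(2)[OF y \<sigma> sy] h hy height_nonneg[of x] height_nonneg[of y] by simp_all
    then have xy: "x (e \<sigma> k) = y (e \<sigma> k)" if "k < r" for k
      using sphere_coord_inj[OF r coords(1)[OF x \<sigma> sx] _ coords(1)[OF y \<sigma> sy] _ c that] by simp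
    have "x v = y v" for v
    proof (cases "v \<in> \<sigma>")
      case True
      then obtain k where "k < r" "v = e \<sigma> k" using e[OF \<sigma>] by (auto simp: bij_betw_def)
      then show ?thesis using xy by simp
    next
      case False
      then have "x v = 0" "y v = 0" using sx sy by blast+
      then show ?thesis by simp
    qed
    then show ?thesis by blast
  qed
  have q_onto: "q ` topspace (top_of_set ?P) = topspace ?W"
  proof (intro equalityI subsetI)
    fix w assume "w \<in> q ` topspace (top_of_set ?P)"
    then show "w \<in> topspace ?W" using continuous_map_image_subset_topspace[OF q_cont] by blast
  next
    fix w assume w: "w \<in> topspace ?W"
    have "w \<in> q ` ?P"
    proof (cases w)
      case None
      define x where "x = (\<lambda>v. if v = v0 then 1 else 0 :: real)"
      have supp: "{v. x v \<noteq> 0} = {v0}" by (auto simp: x_def)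
      have "{v0} \<in> L" using v0 r by (simp add: L)
      moreover have "sum x V = 1" using v0 finV by (simp add: x_def)
      ultimately have x: "x \<in> ?P" by (simp add: mem_P supp) (simp add: x_def)
      have "height x = 0" using height_eq_0_iff[OF x] r by (simp add: supp)
      then show ?thesis using x None q_None[of x] by force
    next
      case (Some jy)
      then obtain j y where jy: "w = Some (j, y)" "j < card Fac" "y \<in> topspace (nsphere (r - 1))" "y \<noteq> base"
        using w unfolding W_top Some by (auto simp: wedge_map_def split: if_splits)
      have "j \<in> idx ` Fac" using idx jy(2) by (simp add: bij_betw_def)
      then obtain \<sigma> where \<sigma>: "\<sigma> \<in> Fac" "idx \<sigma> = j" by blast
      obtain u where u: "u \<in> std_simplex r" "0 < Min (u ` {..<r})" "sphere_coord r u = y"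
        by (rule sphere_coord_surj[OF r jy(3,4)])
      define x where "x v = (if v \<in> \<sigma> then u (inv_into {..<r} (e \<sigma>) v) else 0)" for v
      have xe: "x (e \<sigma> k) = u k" if "k < r" for k
        using that e[OF \<sigma>(1)] by (auto simp: x_def bij_betw_def)
      have e_in: "e \<sigma> k \<in> \<sigma>" if "k < r" for k using that e[OF \<sigma>(1)] by (auto simp: bij_betw_def)
      have u_pos: "0 < u k" if "k < r" for k using Min_le_coord[OF r that, of u] u(2) by simp
      have x_pos: "0 < x v" if v: "v \<in> \<sigma>" for v
      proof -
        obtain k where "k < r" "v = e \<sigma> k" using v e[OF \<sigma>(1)] by (auto simp: bij_betw_def)
        then show ?thesis using xe u_pos by simp
      qed
      have x0: "x v = 0" if "v \<notin> \<sigma>" for v using that by (simp add: x_def)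
      have x_nn: "0 \<le> x v" for v using x_pos[of v] x0[of v] by (cases "v \<in> \<sigma>") auto
      have supp: "{v. x v \<noteq> 0} = \<sigma>" using x_pos x0 by force
      have "sum x V = sum x \<sigma>" using Fac[OF \<sigma>(1)] finV x0 by (intro sum.mono_neutral_right) auto
      also have "\<dots> = (\<Sum>k<r. x (e \<sigma> k))" by (rule sum.reindex_bij_betw[OF e[OF \<sigma>(1)], symmetric])
      also have "\<dots> = (\<Sum>k<r. u k)" by (intro sum.cong) (auto simp: xe)
      also have "\<dots> = 1" using u(1) by (simp add: std_simplex_def)
      finally have "sum x V = 1" .
      moreover have "\<sigma> \<in> L" using \<sigma>(1) by (simp add: L)
      ultimately have x: "x \<in> ?P" using x_nn by (simp add: mem_P supp)
      have "chart \<sigma> x = sphere_coord r u" unfolding chart_def by (rule sphere_coord_cong[OF r xe])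
      then have "q x = w"
        using q_eq[OF x \<sigma>(1)] jy \<sigma>(2) u(3) by (simp add: supp wedge_map_def)
      then show ?thesis using x by blast
    qed
    then show "w \<in> q ` topspace (top_of_set ?P)" by simp
  qed
  show ?thesis
    unfolding geometric_realization_eq_top_of_set
  proof (rule homotopy_equivalent_space_quotient[where q = q and F = shrink])
    show "compact_space (top_of_set ?P)"
      using compact_realization[OF finV L_sub down] by (simp add: compact_space_subtopology)
    show "continuous_map (prod_topology (top_of_set {0..1}) (top_of_set ?P)) (top_of_set ?P) shrink"
      using continuous_on_shrink shrink_mem by auto
    show "shrink (0, x) = x" if "x \<in> topspace (top_of_set ?P)" for x
      using that shrink_0 by simp
    show "q (shrink (t, x)) = q (shrink (t, y))"
      if t: "t \<in> {0..1}" and xy: "x \<in> topspace (top_of_set ?P)" "y \<in> topspace (top_of_set ?P)" "q x = q y" for t x y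
    proof (cases "height x = 0")
      case True
      then have "height y = 0" using xy(3) q_None[of x] q_None[of y] by simp
      then show ?thesis
        using True shrink_height_0_mem(2)[OF t] xy by (simp add: q_def)
    next
      case False
      then show ?thesis using q_inj[of x y] xy by simp
    qed
    show "shrink (1, x) = shrink (1, y)"
      if xy: "x \<in> topspace (top_of_set ?P)" "y \<in> topspace (top_of_set ?P)" "q x = q y" for x y
    proof (cases "height x = 0")
      case True
      then have "height y = 0" using xy(3) q_None[of x] q_None[of y] by simp
      then show ?thesis
        using True shrink_height_0[of 1 x] shrink_height_0[of 1 y] xy by (simp add: fun_eq_iff)
    next
      case False
      then show ?thesis using q_inj[of x y] xy by simp
    qed
  qed (use W_Haus q_cont q_onto in simp_all)
qed

end

section \<open>Independence complexes of complete multipartite graphs\<close>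

text \<open>
  A set of vertices that meets two parts induces a connected subgraph: vertices of distinct parts
  are adjacent, and vertices of the same part have a common neighbour in another part. A subset of
  a single part induces a subgraph without edges, whose components are single vertices.
\<close>

lemma r_independent_complete_multipartite:
  assumes G: "graph G" and disj: "disjoint_family_on V S" and S: "S \<noteq> {}" and r: "r \<ge> 1"
    and verts: "verts G = (\<Union>i\<in>S. V i)"
    and arcs: "arcs_ends G = (\<Union>i\<in>S. \<Union>j\<in>S - {i}. V i \<times> V j)"
  shows "r_independent r G A \<longleftrightarrow> A \<subseteq> verts G \<and> (card A \<le> r \<or> (\<exists>i\<in>S. A \<subseteq> V i))"
proof (cases "A \<subseteq> verts G")
  case True
  interpret graph G by (rule G)
  interpret GA: pre_digraph "G \<restriction> A" .
  have finA: "finite A" using True finite_verts finite_subset by blast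
  have wf: "wf_digraph (G \<restriction> A)" by (rule wellformed_induce_subgraph)
  have ends: "arcs_ends (G \<restriction> A) = arcs_ends G \<inter> A \<times> A"
    by (auto simp: arcs_ends_conv)
  have "(\<forall>H\<in>connected_components (G \<restriction> A). card (verts H) \<le> r) \<longleftrightarrow> card A \<le> r \<or> (\<exists>i\<in>S. A \<subseteq> V i)"
  proof (intro iffI ballI)
    assume comps: "\<forall>H\<in>connected_components (G \<restriction> A). card (verts H) \<le> r"
    show "card A \<le> r \<or> (\<exists>i\<in>S. A \<subseteq> V i)"
    proof (rule disjCI)
      assume spread: "\<not> (\<exists>i\<in>S. A \<subseteq> V i)"
      let ?R = "rtrancl_on A ((arcs_ends (G \<restriction> A))\<^sup>s)"
      have edge: "(u, v) \<in> ?R" if "u \<in> A" "v \<in> A" "i \<in> S" "j \<in> S" "i \<noteq> j" "u \<in> V i" "v \<in> V j" for u v i j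
      proof -
        have "(u, v) \<in> arcs_ends (G \<restriction> A)" using that by (auto simp: ends arcs)
        then have "(u, v) \<in> (arcs_ends (G \<restriction> A))\<^sup>s" by (simp add: symcl_def)
        then show ?thesis using that by (intro rtrancl_on_into_rtrancl_on[OF rtrancl_on_refl])
      qed
      have "(u, v) \<in> ?R" if uv: "u \<in> A" "v \<in> A" for u v
      proof -
        obtain i j where ij: "i \<in> S" "u \<in> V i" "j \<in> S" "v \<in> V j" using uv True verts by blast
        show ?thesis
        proof (cases "i = j")
          case True
          \<comment> \<open>A vertex of another part is adjacent to both.\<close>
          obtain w k where w: "w \<in> A" "w \<notin> V i" "k \<in> S" "w \<in> V k"
            using spread ij(1) \<open>A \<subseteq> verts G\<close> verts by blast
          then have "k \<noteq> i" by blast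
          then have "(u, w) \<in> ?R" "(w, v) \<in> ?R"
            using edge[of u w i k] edge[of w v k i] uv ij w True by auto
          then show ?thesis by (rule rtrancl_on_trans)
        next
          case False
          then show ?thesis using edge uv ij by blast
        qed
      qed
      moreover have "A \<noteq> {}" using spread S by blast
      ultimately have conn: "Digraph_Component.connected (G \<restriction> A)"
        by (simp add: connected_conv)
      have "GA.max_subgraph Digraph_Component.connected (G \<restriction> A)"
      proof (rule GA.max_subgraphI[where P = Digraph_Component.connected, OF conn])
        show "subgraph (G \<restriction> A) (G \<restriction> A)" by (rule wf_digraph.subgraph_refl[OF wf])
        fix H assume "G \<restriction> A \<noteq> H" "subgraph (G \<restriction> A) H" "subgraph H (G \<restriction> A)"
        then have False by (auto simp: subgraph_def compatible_def)
        then show "\<not> Digraph_Component.connected H" ..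
      qed
      then have "G \<restriction> A \<in> connected_components (G \<restriction> A)" by (simp add: connected_components_def)
      then show "card A \<le> r" using comps by force
    qed
  next
    fix H assume A: "card A \<le> r \<or> (\<exists>i\<in>S. A \<subseteq> V i)" and "H \<in> connected_components (G \<restriction> A)"
    then have H: "subgraph H (G \<restriction> A)" and conn: "Digraph_Component.connected H"
      by (simp_all add: connected_components_def GA.max_subgraph_def)
    have HA: "verts H \<subseteq> A" using H by (auto simp: subgraph_def)
    from A show "card (verts H) \<le> r"
    proof
      assume "card A \<le> r"
      then show ?thesis using card_mono[OF finA HA] by simp
    next
      assume "\<exists>i\<in>S. A \<subseteq> V i"
      then obtain i where i: "i \<in> S" "A \<subseteq> V i" by blast
      have only_i: "j = i" if "j \<in> S" "u \<in> V j" "u \<in> A" for j u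
        using disj that i unfolding disjoint_family_on_def by blast
      have "arcs_ends (G \<restriction> A) = {}"
        unfolding ends arcs using only_i by blast
      then have "arcs_ends H = {}" using arcs_ends_mono[OF H] by simp
      then have "(u, v) \<in> rtrancl_on (verts H) {}" if "u \<in> verts H" "v \<in> verts H" for u v
        using conn that by (simp add: connected_conv symcl_def)
      then have "u = v" if "u \<in> verts H" "v \<in> verts H" for u v
        using that by (metis converse_rtrancl_on_cases empty_iff)
      moreover have "finite (verts H)" using HA finA finite_subset by blast
      ultimately have "card (verts H) \<le> 1" by (simp add: card_le_Suc0_iff_eq)
      then show ?thesis using r by simp
    qed
  qed
  then show ?thesis using True by (simp add: r_independent_def)
qed (simp add: r_independent_def)

text \<open>
  In every part \<open>V i\<close> a vertex \<open>c i\<close> is selected. All subsets of \<open>V i\<close> are simplices of the complex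
  defined below, so \<open>c i\<close> is a cone point for the simplices inside \<open>V i\<close>.
\<close>

locale pointed_parts =
  fixes S :: "'i set" and V :: "'i \<Rightarrow> 'a set" and c :: "'i \<Rightarrow> 'a" and r :: nat
  assumes finS: "finite S" and finV: "\<And>i. i \<in> S \<Longrightarrow> finite (V i)" and c: "\<And>i. i \<in> S \<Longrightarrow> c i \<in> V i"
    and disj: "disjoint_family_on V S" and r: "r \<ge> 1"
begin

definition all_vertices :: "'a set" where "all_vertices = (\<Union>i\<in>S. V i)"

definition unpointed :: "'i \<Rightarrow> 'a set" where "unpointed i = V i - {c i}"

definition multipartite_complex :: "'a set set" where
  "multipartite_complex = {A. A \<subseteq> all_vertices \<and> (card A \<le> r \<or> (\<exists>i\<in>S. A \<subseteq> V i))}"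

lemma finite_all_vertices: "finite all_vertices" unfolding all_vertices_def using finS finV by simp

lemma part_unique: "i \<in> S \<Longrightarrow> j \<in> S \<Longrightarrow> v \<in> V i \<Longrightarrow> v \<in> V j \<Longrightarrow> i = j"
  using disj unfolding disjoint_family_on_def by blast

lemma multipartite_complex_down: "\<sigma> \<in> multipartite_complex \<Longrightarrow> \<tau> \<subseteq> \<sigma> \<Longrightarrow> \<tau> \<in> multipartite_complex"
proof -
  assume \<sigma>: "\<sigma> \<in> multipartite_complex" and \<tau>: "\<tau> \<subseteq> \<sigma>"
  have "finite \<sigma>" using \<sigma> finite_all_vertices finite_subset by (auto simp: multipartite_complex_def)
  then have "card \<tau> \<le> card \<sigma>" using \<tau> by (rule card_mono)
  then show "\<tau> \<in> multipartite_complex" using \<sigma> \<tau> unfolding multipartite_complex_def by fastforce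
qed

text \<open>
  A simplex with \<open>r\<close> vertices in \<open>V j - {c j}\<close> has no vertex outside of \<open>V j\<close>: simplices meeting two
  parts have at most \<open>r\<close> vertices altogether.
\<close>

lemma many_in_part:
  assumes "\<sigma> \<in> multipartite_complex" "j \<in> S" "r \<le> card (\<sigma> \<inter> unpointed j)"
  shows "\<sigma> \<subseteq> V j"
proof -
  have fin: "finite \<sigma>" using assms(1) finite_all_vertices finite_subset by (auto simp: multipartite_complex_def)
  consider "card \<sigma> \<le> r" | i where "i \<in> S" "\<sigma> \<subseteq> V i" using assms(1) by (auto simp: multipartite_complex_def)
  then show ?thesis
  proof cases
    case 1
    then have "\<sigma> \<inter> unpointed j = \<sigma>" using assms(3) fin by (intro card_seteq) auto
    then show ?thesis by (auto simp: unpointed_def)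
  next
    case 2
    have "\<sigma> \<inter> unpointed j \<noteq> {}" using assms(3) r by auto
    then obtain v where "v \<in> V i" "v \<in> V j" using 2 by (auto simp: unpointed_def)
    then show ?thesis using part_unique 2 assms(2) by blast
  qed
qed

text \<open>
  The parts are treated one after the other. A simplex with at least \<open>r\<close> vertices in \<open>V j - {c j}\<close>
  lies inside \<open>V j\<close>, so \<open>c j\<close> can be added to it; this is the cone condition for removing it. The
  conditions already imposed for other parts are not affected as these parts are disjoint from \<open>V j\<close>.
\<close>

lemma thin_out:
  assumes "finite T" "T \<subseteq> S"
  shows "geometric_realization multipartite_complex homotopy_equivalent_space
         geometric_realization {\<sigma> \<in> multipartite_complex. \<forall>i\<in>T. card (\<sigma> \<inter> unpointed i) < r}"
  using assms
proof (induction T rule: finite_induct)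
  case empty
  then show ?case by (simp add: homotopy_equivalent_space_refl)
next
  case (insert j T)
  let ?K = "{\<sigma> \<in> multipartite_complex. \<forall>i\<in>T. card (\<sigma> \<inter> unpointed i) < r}"
  have j: "j \<in> S" using insert.prems by simp
  have collapse: "geometric_realization ?K homotopy_equivalent_space
      geometric_realization {\<sigma> \<in> ?K. card (\<sigma> \<inter> unpointed j) < r}"
  proof (rule homotopy_equivalent_space_uncone[OF finite_all_vertices _ _ _ _ r, where c = "c j"])
    show "?K \<subseteq> Pow all_vertices" by (auto simp: multipartite_complex_def)
    show "unpointed j \<subseteq> all_vertices" "c j \<in> all_vertices"
      using j c[OF j] by (auto simp: unpointed_def all_vertices_def)
    show "c j \<notin> unpointed j" by (simp add: unpointed_def)
    show "\<tau> \<in> ?K" if "\<sigma> \<in> ?K" "\<tau> \<subseteq> \<sigma>" for \<sigma> \<tau>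
    proof -
      have fin: "finite \<sigma>" using that(1) finite_all_vertices finite_subset by (auto simp: multipartite_complex_def)
      have "card (\<tau> \<inter> unpointed i) \<le> card (\<sigma> \<inter> unpointed i)" for i using fin that(2) by (intro card_mono) auto
      then show ?thesis using that multipartite_complex_down le_less_trans by blast
    qed
    show "insert (c j) \<sigma> \<in> ?K" if \<sigma>: "\<sigma> \<in> ?K" "r \<le> card (\<sigma> \<inter> unpointed j)" for \<sigma>
    proof -
      have "\<sigma> \<subseteq> V j" using many_in_part \<sigma> j by blast
      then have sub: "insert (c j) \<sigma> \<subseteq> V j" using c[OF j] by blast
      then have "insert (c j) \<sigma> \<in> multipartite_complex"
        using j by (auto simp: multipartite_complex_def all_vertices_def)
      moreover have "insert (c j) \<sigma> \<inter> unpointed i = {}" if "i \<in> T" for i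
      proof -
        have "i \<in> S" "i \<noteq> j" using that insert.hyps insert.prems by auto
        then show ?thesis using part_unique j sub by (fastforce simp: unpointed_def)
      qed
      ultimately show ?thesis using r by simp
    qed
  qed
  have "geometric_realization multipartite_complex homotopy_equivalent_space geometric_realization ?K"
    using insert by simp
  from homotopy_eqv_trans[OF this collapse] show ?case
    by (simp add: conj_ac)
qed

text \<open>
  The simplices of dimension \<open>r - 1\<close> that survive the thinning and do not contain the apex \<open>c i0\<close>.
\<close>

definition facets :: "'i \<Rightarrow> 'a set set" where
  "facets i0 = {\<sigma>. \<sigma> \<subseteq> all_vertices - {c i0} \<and> card \<sigma> = r \<and> (\<forall>i\<in>S. \<not> \<sigma> \<subseteq> unpointed i)}"

text \<open>
  After the thinning, no simplex has more than \<open>r\<close> vertices, because a larger one would lie in some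
  \<open>V i\<close> and have at least \<open>r\<close> vertices in \<open>V i - {c i}\<close>. The remaining simplices with \<open>r\<close> vertices are
  those not contained in any \<open>V i - {c i}\<close>, and sets containing \<open>c i0\<close> satisfy this automatically.
\<close>

lemma thinned_eq:
  assumes i0: "i0 \<in> S"
  shows "{\<sigma> \<in> multipartite_complex. \<forall>i\<in>S. card (\<sigma> \<inter> unpointed i) < r} =
         {\<sigma>. \<sigma> \<subseteq> all_vertices \<and> card (\<sigma> - {c i0}) < r} \<union> facets i0"
    (is "?L = ?R")
proof (intro equalityI subsetI)
  fix \<sigma> assume \<sigma>: "\<sigma> \<in> ?L"
  then have \<sigma>V: "\<sigma> \<subseteq> all_vertices" and thin: "\<And>i. i \<in> S \<Longrightarrow> card (\<sigma> \<inter> unpointed i) < r"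
    by (auto simp: multipartite_complex_def)
  have fin: "finite \<sigma>" using \<sigma>V finite_all_vertices finite_subset by blast
  have le: "card \<sigma> \<le> r"
  proof (rule ccontr)
    assume big: "\<not> card \<sigma> \<le> r"
    then obtain i where i: "i \<in> S" "\<sigma> \<subseteq> V i" using \<sigma> by (auto simp: multipartite_complex_def)
    have "\<sigma> \<inter> unpointed i = \<sigma> - {c i}" using i by (auto simp: unpointed_def)
    moreover have "card \<sigma> - 1 \<le> card (\<sigma> - {c i})" using diff_card_le_card_Diff[of "{c i}" \<sigma>] by simp
    ultimately show False using thin[OF i(1)] big by simp
  qed
  show "\<sigma> \<in> ?R"
  proof (cases "card (\<sigma> - {c i0}) < r")
    case True
    then show ?thesis using \<sigma>V by simp
  next
    case False
    have "c i0 \<notin> \<sigma>" using False le card_Diff1_less[OF fin, of "c i0"] by linarith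
    moreover have "card \<sigma> = r" using False le card_Diff1_le[of \<sigma> "c i0"] by linarith
    moreover have "\<not> \<sigma> \<subseteq> unpointed i" if "i \<in> S" for i
      using thin[OF that] \<open>card \<sigma> = r\<close> by (auto simp: Int_absorb2)
    ultimately show ?thesis using \<sigma>V by (auto simp: facets_def)
  qed
next
  fix \<sigma> assume "\<sigma> \<in> ?R"
  then consider "\<sigma> \<subseteq> all_vertices" "card (\<sigma> - {c i0}) < r" | "\<sigma> \<in> facets i0" by blast
  then show "\<sigma> \<in> ?L"
  proof cases
    case 1
    have fin: "finite \<sigma>" using 1 finite_all_vertices finite_subset by blast
    have "card \<sigma> - 1 \<le> card (\<sigma> - {c i0})" using diff_card_le_card_Diff[of "{c i0}" \<sigma>] by simp
    then have "card \<sigma> \<le> r" using 1 by linarith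
    then have "\<sigma> \<in> multipartite_complex" using 1 by (simp add: multipartite_complex_def)
    moreover have "card (\<sigma> \<inter> unpointed i) < r" if i: "i \<in> S" for i
    proof -
      have "c i0 \<notin> unpointed i" using part_unique[OF i i0, of "c i0"] c[OF i0] by (auto simp: unpointed_def)
      then have "card (\<sigma> \<inter> unpointed i) \<le> card (\<sigma> - {c i0})" using fin by (intro card_mono) auto
      then show ?thesis using 1 by simp
    qed
    ultimately show ?thesis by simp
  next
    case 2
    then have \<sigma>: "\<sigma> \<subseteq> all_vertices" "card \<sigma> = r" "\<And>i. i \<in> S \<Longrightarrow> \<not> \<sigma> \<subseteq> unpointed i" by (auto simp: facets_def)
    have fin: "finite \<sigma>" using \<sigma> finite_all_vertices finite_subset by blast
    have "card (\<sigma> \<inter> unpointed i) < r" if "i \<in> S" for i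
    proof -
      have "\<sigma> \<inter> unpointed i \<subset> \<sigma>" using \<sigma>(3)[OF that] by blast
      then show ?thesis using psubset_card_mono[OF fin] \<sigma>(2) by blast
    qed
    then show ?thesis using \<sigma> by (simp add: multipartite_complex_def)
  qed
qed

text \<open>
  The subsets of size \<open>r\<close> of the complement of \<open>c i0\<close> are the facets and, for each \<open>i\<close>, the subsets of
  \<open>V i - {c i}\<close>. As \<open>r\<close> is positive, the latter are different for different \<open>i\<close>.
\<close>

lemma card_facets:
  assumes i0: "i0 \<in> S"
  shows "int (card (facets i0)) = int ((card all_vertices - 1) choose r)
    - (\<Sum>i\<in>S. int ((card (V i) - 1) choose r))"
proof -
  let ?sub = "\<lambda>A. {\<sigma>. \<sigma> \<subseteq> A \<and> card \<sigma> = r}"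
  have finB: "finite (unpointed i)" and cardB: "card (unpointed i) = card (V i) - 1" if "i \<in> S" for i
    using finV[OF that] c[OF that] by (simp_all add: unpointed_def)
  have BW: "unpointed i \<subseteq> all_vertices - {c i0}" if i: "i \<in> S" for i
    using part_unique[OF i i0, of "c i0"] c[OF i0] i by (auto simp: unpointed_def all_vertices_def)
  have fin: "finite (?sub (all_vertices - {c i0}))"
    by (rule finite_subset[of _ "Pow all_vertices"]) (auto simp: finite_all_vertices)
  have split: "?sub (all_vertices - {c i0}) = facets i0 \<union> (\<Union>i\<in>S. ?sub (unpointed i))"
    unfolding facets_def using BW by blast
  have "card (?sub (all_vertices - {c i0})) = card (facets i0) + card (\<Union>i\<in>S. ?sub (unpointed i))"
    unfolding split
  proof (rule card_Un_disjoint)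
    show "finite (facets i0)" "finite (\<Union>i\<in>S. ?sub (unpointed i))" using fin unfolding split by simp_all
    show "facets i0 \<inter> (\<Union>i\<in>S. ?sub (unpointed i)) = {}" by (auto simp: facets_def)
  qed
  also have "card (\<Union>i\<in>S. ?sub (unpointed i)) = (\<Sum>i\<in>S. card (?sub (unpointed i)))"
  proof (rule card_UN_disjoint[OF finS])
    show "\<forall>i\<in>S. finite (?sub (unpointed i))" using finB by (auto intro: finite_subset[of _ "Pow (unpointed _)"])
    show "\<forall>i\<in>S. \<forall>j\<in>S. i \<noteq> j \<longrightarrow> ?sub (unpointed i) \<inter> ?sub (unpointed j) = {}"
    proof (intro ballI impI)
      fix i j assume ij: "i \<in> S" "j \<in> S" "i \<noteq> j"
      have "\<sigma> = {}" if "\<sigma> \<subseteq> unpointed i" "\<sigma> \<subseteq> unpointed j" for \<sigma>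
        using that part_unique[OF ij(1,2)] ij(3) by (auto simp: unpointed_def)
      then have "\<sigma> \<notin> ?sub (unpointed i) \<inter> ?sub (unpointed j)" for \<sigma> using r by (cases "\<sigma> = {}") auto
      then show "?sub (unpointed i) \<inter> ?sub (unpointed j) = {}" by blast
    qed
  qed
  also have "\<dots> = (\<Sum>i\<in>S. (card (V i) - 1) choose r)"
    using n_subsets[OF finB] cardB by (intro sum.cong) auto
  finally have total: "card (?sub (all_vertices - {c i0})) = card (facets i0) + (\<Sum>i\<in>S. (card (V i) - 1) choose r)" .
  have "c i0 \<in> all_vertices" using c[OF i0] i0 by (auto simp: all_vertices_def)
  then have "card (?sub (all_vertices - {c i0})) = (card all_vertices - 1) choose r"
    using n_subsets[of "all_vertices - {c i0}" r] finite_all_vertices by simp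
  with total show ?thesis by simp
qed

lemma homotopy_equivalent_wedge:
  assumes i0: "i0 \<in> S"
  shows "geometric_realization multipartite_complex homotopy_equivalent_space
         wedge_of_spheres (card (facets i0)) (r - 1)"
proof -
  let ?L = "{\<sigma> \<in> multipartite_complex. \<forall>i\<in>S. card (\<sigma> \<inter> unpointed i) < r}"
  interpret skeleton_with_facets all_vertices "c i0" r "facets i0" ?L
  proof
    show "finite all_vertices" by (rule finite_all_vertices)
    show "c i0 \<in> all_vertices" using i0 c by (auto simp: all_vertices_def)
    show "r \<ge> 1" by (rule r)
    show "\<sigma> \<subseteq> all_vertices - {c i0} \<and> card \<sigma> = r" if "\<sigma> \<in> facets i0" for \<sigma> using that by (simp add: facets_def)
    show "?L = {\<sigma>. \<sigma> \<subseteq> all_vertices \<and> card (\<sigma> - {c i0}) < r} \<union> facets i0" by (rule thinned_eq[OF i0])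
  qed
  show ?thesis
    using thin_out[OF finS subset_refl] skeleton_homotopy_equivalent_wedge by (rule homotopy_eqv_trans)
qed

end

theorem theorem3p5:
  fixes s r :: nat and m :: "nat \<Rightarrow> nat" and G :: "('a, 'b) pre_digraph"
  assumes "s \<ge> 2" and "r \<ge> 1" and "\<And>i. i \<in> {1..s} \<Longrightarrow> m i \<ge> 1"
    and "complete_multipartite_digraph s m G"
  defines "M \<equiv> \<Sum>i=1..s. m i"
  shows "\<exists>t::nat. int t = int ((M - 1) choose r) - (\<Sum>i=1..s. int ((m i - 1) choose r)) \<and>
    geometric_realization (independence_complex r G) homotopy_equivalent_space
      wedge_of_spheres t (r - 1)"
proof -
  note multipartite = assms(4)[unfolded complete_multipartite_digraph_def]
  have G: "graph G" by (rule conjunct1[OF multipartite])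
  from conjunct2[OF multipartite]
  obtain V where disj: "disjoint_family_on V {1..s}"
    and verts: "verts G = (\<Union>i\<in>{1..s}. V i)" and m: "\<forall>i\<in>{1..s}. card (V i) = m i"
    and arcs: "arcs_ends G = (\<Union>i\<in>{1..s}. \<Union>j\<in>{1..s} - {i}. V i \<times> V j)"
    by (elim exE conjE)
  have card_V: "card (V i) = m i" if "i \<in> {1..s}" for i using m that by blast
  have card_pos: "0 < card (V i)" if "i \<in> {1..s}" for i
    using assms(3)[OF that] card_V[OF that] by linarith
  have "\<forall>i\<in>{1..s}. \<exists>v. v \<in> V i"
  proof
    fix i assume "i \<in> {1..s}"
    from card_pos[OF this] have "V i \<noteq> {}" by auto
    then show "\<exists>v. v \<in> V i" by blast
  qed
  from bchoice[OF this] obtain c where c: "\<forall>i\<in>{1..s}. c i \<in> V i" by blast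
  interpret pointed_parts "{1..s}" V c r
  proof
    show "finite (V i)" if "i \<in> {1..s}" for i by (rule card_ge_0_finite[OF card_pos[OF that]])
    show "c i \<in> V i" if "i \<in> {1..s}" for i using c that by blast
  qed (use disj assms(2) in simp_all)
  have one: "1 \<in> {1..s}" using assms(1) by simp
  then have ne: "{1..s} \<noteq> {}" by blast
  have "r_independent r G A \<longleftrightarrow> A \<in> multipartite_complex" for A
    unfolding r_independent_complete_multipartite[OF G disj ne assms(2) verts arcs]
      multipartite_complex_def all_vertices_def verts
    by (rule mem_Collect_eq[symmetric])
  then have complex: "independence_complex r G = multipartite_complex"
    by (auto simp: independence_complex_def)
  have "card all_vertices = (\<Sum>i=1..s. card (V i))"
    unfolding all_vertices_def using finV disj by (intro card_UN_disjoint) (auto simp: disjoint_family_on_def)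
  also have "\<dots> = M" unfolding M_def using card_V by (rule sum.cong[OF refl])
  finally have "card all_vertices = M" .
  then have "int (card (facets 1)) = int ((M - 1) choose r) - (\<Sum>i=1..s. int ((m i - 1) choose r))"
    using card_facets[OF one] card_V by simp
  then show ?thesis
    using homotopy_equivalent_wedge[OF one] unfolding complex by blast
qed

end
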